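(* Let $0 \le \alpha < 1$ and $\theta > -\alpha$, let $P_\bullet = (P_1,P_2,\ldots)$ have the $\mathsf{GEM}(\alpha,\theta)$ distribution, let $n\ge 1$, and let $X_1,\ldots,X_n$ be a random sample of size $n$ from $P_\bullet$. Then the sequence $N^{X\uparrow}_{\bullet:n}$ of value-ordered sample frequencies is a $(\text{size}-\alpha)$-biased random permutation of the sample frequencies, whether these are listed in ranked order or in order of appearance. That is, for every composition $(n_1,\ldots,n_k)$ of $n$ which is a possible value of the ranked frequencies $N^{\downarrow}_{\bullet:n}$ (respectively of the appearance-ordered frequencies $N^{*}_{\bullet:n}$), the conditional distribution of $N^{X\uparrow}_{\bullet:n}$ given $N^{\downarrow}_{\bullet:n}=(n_1,\ldots,n_k)$ (respectively given $N^{*}_{\bullet:n}=(n_1,\ldots,n_k)$) is the distribution of a $(\text{size}-\alpha)$-biased random permutation of $(n_1,\ldots,n_k)$.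
   Context: $\mathsf{GEM}(\alpha,\theta)$ distribution: the law of $P_\bullet=(P_1,P_2,\ldots)$ with $P_j = H_j\prod_{i=1}^{j-1}(1-H_i)$, where $H_1,H_2,\ldots$ are independent and $H_i$ has the beta$(1-\alpha,\theta+i\alpha)$ distribution on $(0,1)$ (beta$(a,b)$ has density proportional to $u^{a-1}(1-u)^{b-1}$). A random sample $X_1,\ldots,X_n$ from $P_\bullet$ means that, conditionally given $P_\bullet$, the $X_i$ are i.i.d. with $\mathbb{P}(X_i=j\mid P_\bullet)=P_j$ for $j=1,2,\ldots$. The clusters of the sample are the equivalence classes of $[n]=\{1,\ldots,n\}$ under $i\sim j \iff X_i=X_j$. The value of a cluster is the common value of $X_i$ for $i$ in the cluster. A composition of $n$ is a finite sequence of strictly positive integers with sum $n$. - $N^{X\uparrow}_{\bullet:n}$ (value-ordered frequencies) is the list of cluster sizes in increasing order of the values of the clusters. - $N^{*}_{\bullet:n}$ (appearance-ordered frequencies) is the list of cluster sizes in order of the least elements of the clusters. - $N^{\downarrow}_{\bullet:n}$ (ranked frequencies) is the list of cluster sizes in weakly decreasing order. A $(\text{size}-\alpha)$-biased random permutation of a composition $(n_1,\ldots,n_k)$ is the random sequence $(n_{\pi(1)},\ldots,n_{\pi(k)})$, where $\pi$ is a random permutation of $[k]$ obtained by successive picks without replacement: at each step, if $S\subseteq[k]$ is the set of indices not yet chosen, index $i\in S$ is chosen with probability $(n_i-\alpha)/\sum_{j\in S}(n_j-\alpha)$. Equivalently, $\mathbb{P}(\pi=\sigma)=\prod_{i=1}^k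 \frac{n_{\sigma(i)}-\alpha}{\sum_{j=i}^k (n_{\sigma(j)}-\alpha)}$ for each permutation $\sigma$ of $[k]$. *)

theory Defs
  imports "HOL-Probability.Probability"
begin

section \<open>The GEM distribution\<close>

definition beta_distribution :: "real \<Rightarrow> real \<Rightarrow> real measure" where
  "beta_distribution a b = density lborel
     (\<lambda>u. ennreal (indicator {0<..<1} u * (u powr (a - 1) * (1 - u) powr (b - 1)) / Beta a b))"

lemma sets_beta_distribution [measurable_cong, simp]: "sets (beta_distribution a b) = sets borel"
  by (simp add: beta_distribution_def)

lemma prob_space_beta_distribution:
  assumes "a > 0" "b > 0"
  shows "prob_space (beta_distribution a b)"
proof
  let ?f = "\<lambda>u. indicator {0<..<1} u * (u powr (a - 1) * (1 - u) powr (b - 1)) / Beta a b"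
  have B: "Beta a b > 0"
    using assms by (simp add: Beta_def Gamma_real_pos)
  have "((\<lambda>t. t powr (a - 1) * (1 - t) powr (b - 1)) has_integral Beta a b) {0<..<1}"
    using has_integral_Beta_real[OF assms] by (simp add: has_integral_Icc_iff_Ioo)
  from has_integral_divide[OF this, of "Beta a b"]
  have "((\<lambda>t. t powr (a - 1) * (1 - t) powr (b - 1) / Beta a b) has_integral 1) {0<..<1}"
    using B by simp
  then have "((\<lambda>t. if t \<in> {0<..<1} then t powr (a - 1) * (1 - t) powr (b - 1) / Beta a b else 0)
      has_integral 1) UNIV"
    by (subst has_integral_restrict_UNIV)
  then have "(?f has_integral 1) UNIV"
    by (rule has_integral_eq[rotated]) (auto simp: indicator_def)
  then have "integral\<^sup>N lborel ?f = ennreal 1"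
    using B by (intro nn_integral_has_integral_lborel) auto
  then show "emeasure (beta_distribution a b) (space (beta_distribution a b)) = 1"
    by (simp add: beta_distribution_def emeasure_density)
qed

text \<open>Sequences \<open>(P\<^sub>1, P\<^sub>2, \<dots>)\<close> are functions of the index set \<open>{1..}\<close>, i.e. points of the
  product space below (extended by \<open>undefined\<close> at index \<open>0\<close>).\<close>

abbreviation seq_space :: "(nat \<Rightarrow> real) measure" where
  "seq_space \<equiv> \<Pi>\<^sub>M j\<in>{1..}. borel"

definition stick_breaking :: "(nat \<Rightarrow> real) \<Rightarrow> nat \<Rightarrow> real" where
  "stick_breaking h = (\<lambda>j\<in>{1..}. h j * (\<Prod>i\<in>{1..<j}. (1 - h i)))"

definition GEM :: "real \<Rightarrow> real \<Rightarrow> (nat \<Rightarrow> real) measure" where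
  "GEM \<alpha> \<theta> =
     distr (\<Pi>\<^sub>M i\<in>{1..}. beta_distribution (1 - \<alpha>) (\<theta> + real i * \<alpha>)) seq_space stick_breaking"

definition rv_seq :: "(nat \<Rightarrow> 'a \<Rightarrow> real) \<Rightarrow> 'a \<Rightarrow> nat \<Rightarrow> real" where
  "rv_seq P \<omega> = (\<lambda>j\<in>{1..}. P j \<omega>)"

definition GEM_distributed :: "'a measure \<Rightarrow> (nat \<Rightarrow> 'a \<Rightarrow> real) \<Rightarrow> real \<Rightarrow> real \<Rightarrow> bool" where
  "GEM_distributed M P \<alpha> \<theta> \<longleftrightarrow>
     rv_seq P \<in> M \<rightarrow>\<^sub>M seq_space \<and> distr M seq_space (rv_seq P) = GEM \<alpha> \<theta>"


section \<open>Random samples\<close>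

definition prob_given :: "'a measure \<Rightarrow> 'a measure \<Rightarrow> 'a set \<Rightarrow> 'a \<Rightarrow> real" where
  "prob_given M F A = real_cond_exp M F (indicator A)"

text \<open>As in the library's \<open>indep_sets\<close>, the product rule is required for every finite
  subfamily.\<close>

definition cond_indep_vars ::
  "'a measure \<Rightarrow> 'a measure \<Rightarrow> 'b measure \<Rightarrow> ('i \<Rightarrow> 'a \<Rightarrow> 'b) \<Rightarrow> 'i set \<Rightarrow> bool" where
  "cond_indep_vars M F N X I \<longleftrightarrow>
     (\<forall>i\<in>I. X i \<in> M \<rightarrow>\<^sub>M N) \<and>
     (\<forall>J A. finite J \<longrightarrow> J \<subseteq> I \<longrightarrow> (\<forall>i\<in>J. A i \<in> sets N) \<longrightarrow>
       (AE \<omega> in M. prob_given M F {\<omega>' \<in> space M. \<forall>i\<in>J. X i \<omega>' \<in> A i} \<omega> =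
          (\<Prod>i\<in>J. prob_given M F {\<omega>' \<in> space M. X i \<omega>' \<in> A i} \<omega>)))"

text \<open>The sigma-algebra on \<open>space M\<close> generated by \<open>(P\<^sub>1, P\<^sub>2, \<dots>)\<close>.\<close>

definition sigma_gen :: "'a measure \<Rightarrow> (nat \<Rightarrow> 'a \<Rightarrow> real) \<Rightarrow> 'a measure" where
  "sigma_gen M P = vimage_algebra (space M) (rv_seq P) seq_space"

definition random_sample ::
  "'a measure \<Rightarrow> (nat \<Rightarrow> 'a \<Rightarrow> real) \<Rightarrow> nat \<Rightarrow> (nat \<Rightarrow> 'a \<Rightarrow> nat) \<Rightarrow> bool" where
  "random_sample M P n X \<longleftrightarrow>
     cond_indep_vars M (sigma_gen M P) (count_space {1..}) X {1..n} \<and>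
     (\<forall>i\<in>{1..n}. \<forall>j\<ge>1.
        AE \<omega> in M. prob_given M (sigma_gen M P) {\<omega>' \<in> space M. X i \<omega>' = j} \<omega> = P j \<omega>)"


section \<open>Clusters and their frequencies\<close>

definition clusters :: "nat \<Rightarrow> (nat \<Rightarrow> nat) \<Rightarrow> nat set set" where
  "clusters n x = {1..n} // {(i, j). i \<in> {1..n} \<and> j \<in> {1..n} \<and> x i = x j}"

definition cluster_value :: "(nat \<Rightarrow> nat) \<Rightarrow> nat set \<Rightarrow> nat" where
  "cluster_value x C = the_elem (x ` C)"

definition value_ordered_freqs :: "nat \<Rightarrow> (nat \<Rightarrow> nat) \<Rightarrow> nat list" where
  "value_ordered_freqs n x = map card (sorted_key_list_of_set (cluster_value x) (clusters n x))"

definition appearance_ordered_freqs :: "nat \<Rightarrow> (nat \<Rightarrow> nat) \<Rightarrow> nat list" where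
  "appearance_ordered_freqs n x = map card (sorted_key_list_of_set Min (clusters n x))"

definition ranked_freqs :: "nat \<Rightarrow> (nat \<Rightarrow> nat) \<Rightarrow> nat list" where
  "ranked_freqs n x =
     rev (sorted_list_of_multiset (image_mset card (mset_set (clusters n x))))"

definition composition :: "nat \<Rightarrow> nat list \<Rightarrow> bool" where
  "composition n ns \<longleftrightarrow> (\<forall>m\<in>set ns. m > 0) \<and> sum_list ns = n"


section \<open>Size-biased random permutations\<close>

text \<open>A pick from the index set \<open>S\<close>. The weights sum to one if \<open>S\<close> is a nonempty finite set of
  indices of a composition and \<open>\<alpha> < 1\<close>; see \<open>pmf_biased_pick\<close>.\<close>

definition biased_pick :: "real \<Rightarrow> nat list \<Rightarrow> nat set \<Rightarrow> nat pmf" where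
  "biased_pick \<alpha> ns S =
     embed_pmf (\<lambda>i. if i \<in> S then (real (ns ! i) - \<alpha>) / (\<Sum>j\<in>S. (real (ns ! j) - \<alpha>)) else 0)"

lemma pmf_biased_pick:
  assumes "\<alpha> < 1" "finite S" "S \<noteq> {}" "\<And>i. i \<in> S \<Longrightarrow> ns ! i > 0"
  shows "pmf (biased_pick \<alpha> ns S) i =
    (if i \<in> S then (real (ns ! i) - \<alpha>) / (\<Sum>j\<in>S. (real (ns ! j) - \<alpha>)) else 0)"
proof -
  let ?D = "\<Sum>j\<in>S. (real (ns ! j) - \<alpha>)"
  let ?f = "\<lambda>i. if i \<in> S then (real (ns ! i) - \<alpha>) / ?D else 0"
  have pos: "real (ns ! i) - \<alpha> > 0" if "i \<in> S" for i
    using assms(4)[OF that] assms(1) by linarith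
  have D: "?D > 0"
    using assms pos by (intro sum_pos) auto
  have nonneg: "0 \<le> ?f i" for i
    using pos[of i] D by (auto intro: divide_nonneg_pos)
  have "(\<integral>\<^sup>+i. ennreal (?f i) \<partial>count_space UNIV) = (\<Sum>i\<in>S. ennreal (?f i))"
    using assms by (intro nn_integral_count_space') auto
  also have "\<dots> = ennreal (\<Sum>i\<in>S. ?f i)"
    by (intro sum_ennreal nonneg)
  also have "(\<Sum>i\<in>S. ?f i) = 1"
    using D by (simp flip: sum_divide_distrib)
  finally show ?thesis
    unfolding biased_pick_def using nonneg by (subst pmf_embed_pmf) auto
qed

text \<open>\<open>biased_picks \<alpha> ns S m\<close> is the law of the list of \<open>m\<close> successive picks without replacement
  from the index set \<open>S\<close>.\<close>

primrec biased_picks :: "real \<Rightarrow> nat list \<Rightarrow> nat set \<Rightarrow> nat \<Rightarrow> nat list pmf" where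
  "biased_picks \<alpha> ns S 0 = return_pmf []"
| "biased_picks \<alpha> ns S (Suc m) =
     bind_pmf (biased_pick \<alpha> ns S) (\<lambda>i. map_pmf (Cons i) (biased_picks \<alpha> ns (S - {i}) m))"

definition size_biased_permutation :: "real \<Rightarrow> nat list \<Rightarrow> nat list pmf" where
  "size_biased_permutation \<alpha> ns =
     map_pmf (map (\<lambda>i. ns ! i)) (biased_picks \<alpha> ns {..<length ns} (length ns))"

end

theory Submission
  imports Defs
begin

text \<open>
  The law of the ordered list of clusters can be computed exactly, and it factorizes.  Let
  \<open>C\<^sub>1, \<dots>, C\<^sub>k\<close> be disjoint nonempty sets with union \<open>{1..n}\<close>, of sizes \<open>m\<^sub>1, \<dots>, m\<^sub>k\<close>.  The
  probability that these are the clusters of the sample, in increasing order of their values, is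
  \[ p(m_1, \dots, m_k) \prod_{i=1}^{k} \frac{m_i - \alpha}{\sum_{j=i}^{k} (m_j - \alpha)}, \]
  where \<open>p\<close> (\<open>eppf\<close> below) is the symmetric function known as the exchangeable partition probability
  function of the two-parameter model, and the product (\<open>pick_prob\<close>) is the probability that a
  (size minus \<open>\<alpha>\<close>)-biased permutation of the blocks produces this order
  (\<open>prob_ordered_clusters\<close>).  Given the unordered partition, the factor \<open>p\<close> is constant, so the
  order of the blocks is a biased permutation.  Any listing of the block sizes
  that is a function of the unordered partition carries less information than the partition, and
  the conditional law of the value-ordered sizes depends on the partition only through the
  multiset of block sizes, so conditioning on such a listing gives the same law
  (\<open>cond_prob_value_ordered_freqs\<close>).  The ranked and the appearance-ordered frequencies are
  two such listings.

  For the formula itself, regard the values \<open>1, 2, \<dots>\<close> as boxes.  The probability that the sample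
  fills boxes \<open>1, \<dots>, L\<close> in a prescribed way is a product of beta moments, one for each box, because
  the \<open>H\<^sub>j\<close> are independent (\<open>expectation_GEM_monomial\<close>).  It remains to sum over all ways of
  interspersing the prescribed blocks with empty boxes.  Splitting according to whether box \<open>1\<close> is
  empty gives a recursion in which \<open>\<theta>\<close> is replaced by \<open>\<theta> + \<alpha>\<close>, since discarding the first stick
  turns GEM\<open>(\<alpha>, \<theta>)\<close> into GEM\<open>(\<alpha>, \<theta> + \<alpha>)\<close>.  The claimed closed form satisfies the same recursion
  (\<open>full_box_ordered_eppf\<close>, \<open>empty_box_ordered_eppf\<close>): of its value, box \<open>1\<close> being empty
  contributes the fraction \<open>(\<theta> + k\<alpha>) / (\<theta> + n)\<close>, and box \<open>1\<close> holding the first block the rest.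
  The relative error of the sum over finitely many boxes is thus controlled by the product of these
  fractions along \<open>\<theta>, \<theta> + \<alpha>, \<theta> + 2\<alpha>, \<dots>\<close>, which tends to \<open>0\<close> because the harmonic series
  diverges (\<open>padded_sum_tendsto\<close>).
\<close>

section \<open>The probability of an ordered partition, summed over the empty boxes\<close>

text \<open>The moment \<open>E[H\<^sup>c (1 - H)\<^sup>s]\<close> of a beta\<open>(1 - \<alpha>, \<theta> + \<alpha>)\<close> variable: given that \<open>c + s\<close> sample
  points have not fallen in an earlier box, the weight of \<open>c\<close> specified ones falling in the current
  box and \<open>s\<close> in later ones.\<close>

definition box_moment :: "real \<Rightarrow> real \<Rightarrow> nat \<Rightarrow> nat \<Rightarrow> real" where
  "box_moment \<alpha> \<theta> c s =
     pochhammer (1 - \<alpha>) c * pochhammer (\<theta> + \<alpha>) s / pochhammer (\<theta> + 1) (c + s)"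

text \<open>The weight of a sample with the given numbers of points in boxes \<open>1, 2, \<dots>\<close>, all its points
  being in the listed boxes.  Passing to the next box shifts \<open>\<theta>\<close> by \<open>\<alpha>\<close>.\<close>

primrec boxes_prob :: "real \<Rightarrow> real \<Rightarrow> nat list \<Rightarrow> real" where
  "boxes_prob \<alpha> \<theta> [] = 1"
| "boxes_prob \<alpha> \<theta> (c # cs) = box_moment \<alpha> \<theta> c (sum_list cs) * boxes_prob \<alpha> (\<theta> + \<alpha>) cs"

text \<open>All contents of \<open>L\<close> successive boxes that show the blocks \<open>Cs\<close> in this order once the empty boxes
  are skipped.\<close>

definition paddings :: "nat \<Rightarrow> 'b set list \<Rightarrow> 'b set list set" where
  "paddings L Cs = {Ds. length Ds = L \<and> filter (\<lambda>D. D \<noteq> {}) Ds = Cs}"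

definition padded_sum :: "real \<Rightarrow> real \<Rightarrow> 'b set list \<Rightarrow> nat \<Rightarrow> real" where
  "padded_sum \<alpha> \<theta> Cs L = (\<Sum>Ds\<in>paddings L Cs. boxes_prob \<alpha> \<theta> (map card Ds))"

text \<open>The probability that successive (size minus \<open>\<alpha>\<close>)-biased picks of blocks with these sizes come in
  exactly this order.\<close>

primrec pick_prob :: "real \<Rightarrow> nat list \<Rightarrow> real" where
  "pick_prob \<alpha> [] = 1"
| "pick_prob \<alpha> (m # ms) =
     (real m - \<alpha>) / (\<Sum>l\<leftarrow>m # ms. real l - \<alpha>) * pick_prob \<alpha> ms"

text \<open>The exchangeable partition probability function of the two-parameter model.  Factors \<open>\<theta>\<close>, which may
  vanish, have been cancelled from the usual ratio of rising factorials; with truncated subtraction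
  the value at the empty list is \<open>1\<close>.\<close>

definition eppf :: "real \<Rightarrow> real \<Rightarrow> nat list \<Rightarrow> real" where
  "eppf \<alpha> \<theta> ms =
     (\<Prod>i\<in>{1..<length ms}. \<theta> + real i * \<alpha>) / pochhammer (\<theta> + 1) (sum_list ms - 1)
       * (\<Prod>m\<leftarrow>ms. pochhammer (1 - \<alpha>) (m - 1))"

lemma paddings_Nil: "paddings L [] = {replicate L {}}"
  unfolding paddings_def by (auto simp: filter_empty_conv intro: replicate_eqI)

lemma paddings_0_Cons: "paddings 0 (C # Cs) = {}"
  by (auto simp: paddings_def)

lemma paddings_Suc_Cons:
  assumes "C \<noteq> {}"
  shows "paddings (Suc L) (C # Cs) = (#) C ` paddings L Cs \<union> (#) {} ` paddings L (C # Cs)"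
proof -
  have "Ds \<in> paddings (Suc L) (C # Cs) \<longleftrightarrow>
      Ds \<in> (#) C ` paddings L Cs \<union> (#) {} ` paddings L (C # Cs)" for Ds
    using assms by (cases Ds) (auto simp: paddings_def)
  then show ?thesis by blast
qed

lemma finite_paddings:
  assumes "\<forall>C\<in>set Cs. C \<noteq> {}"
  shows "finite (paddings L Cs)"
  using assms
proof (induction L arbitrary: Cs)
  case 0
  then show ?case by (simp add: paddings_def)
next
  case (Suc L)
  then show ?case
    by (cases Cs) (simp_all add: paddings_Nil paddings_Suc_Cons)
qed

lemma sum_list_card_padding:
  assumes "Ds \<in> paddings L Cs"
  shows "(\<Sum>D\<leftarrow>Ds. card D) = (\<Sum>C\<leftarrow>Cs. card C)"
proof -
  have "(\<Sum>D\<leftarrow>Ds. card D) = (\<Sum>D\<leftarrow>filter (\<lambda>D. D \<noteq> {}) Ds. card D)"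
    by (induction Ds) auto
  then show ?thesis
    using assms by (metis (mono_tags, lifting) mem_Collect_eq paddings_def)
qed

lemma box_moment_0_0 [simp]: "box_moment \<alpha> \<theta> 0 0 = 1"
  by (simp add: box_moment_def)

lemma boxes_prob_zeros: "boxes_prob \<alpha> \<theta> (replicate L 0) = 1"
  by (induction L arbitrary: \<theta>) (auto simp: sum_list_replicate)

lemma padded_sum_Nil: "padded_sum \<alpha> \<theta> [] L = 1"
  by (simp add: padded_sum_def paddings_Nil boxes_prob_zeros)

lemma padded_sum_0_Cons: "padded_sum \<alpha> \<theta> (C # Cs) 0 = 0"
  by (simp add: padded_sum_def paddings_0_Cons)

text \<open>The first box either holds the first block or is empty; this is the recursion that determines the
  law of the ordered partition.\<close>

lemma padded_sum_Suc_Cons: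
  assumes "\<forall>D\<in>set (C # Cs). D \<noteq> {}"
  shows "padded_sum \<alpha> \<theta> (C # Cs) (Suc L) =
    box_moment \<alpha> \<theta> (card C) (\<Sum>D\<leftarrow>Cs. card D) * padded_sum \<alpha> (\<theta> + \<alpha>) Cs L +
    box_moment \<alpha> \<theta> 0 (\<Sum>D\<leftarrow>C # Cs. card D) * padded_sum \<alpha> (\<theta> + \<alpha>) (C # Cs) L"
proof -
  have fin: "finite (paddings L Cs)" "finite (paddings L (C # Cs))"
    using assms by (auto intro!: finite_paddings)
  have "padded_sum \<alpha> \<theta> (C # Cs) (Suc L) =
      (\<Sum>Ds\<in>(#) C ` paddings L Cs. boxes_prob \<alpha> \<theta> (map card Ds)) +
      (\<Sum>Ds\<in>(#) {} ` paddings L (C # Cs). boxes_prob \<alpha> \<theta> (map card Ds))"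
    unfolding padded_sum_def using assms fin
    by (subst paddings_Suc_Cons, simp, intro sum.union_disjoint) auto
  also have "\<dots> = (\<Sum>Ds\<in>paddings L Cs. boxes_prob \<alpha> \<theta> (map card (C # Ds))) +
      (\<Sum>Ds\<in>paddings L (C # Cs). boxes_prob \<alpha> \<theta> (map card ({} # Ds)))"
    by (simp add: sum.reindex)
  also have "\<dots> = (\<Sum>Ds\<in>paddings L Cs. box_moment \<alpha> \<theta> (card C) (\<Sum>D\<leftarrow>Cs. card D)
                     * boxes_prob \<alpha> (\<theta> + \<alpha>) (map card Ds)) +
      (\<Sum>Ds\<in>paddings L (C # Cs). box_moment \<alpha> \<theta> 0 (\<Sum>D\<leftarrow>C # Cs. card D)
                     * boxes_prob \<alpha> (\<theta> + \<alpha>) (map card Ds))"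
    by (intro arg_cong2[of _ _ _ _ "(+)"] sum.cong refl)
       (auto dest!: sum_list_card_padding)
  finally show ?thesis
    by (simp add: padded_sum_def sum_distrib_left)
qed

lemma box_moment_nonneg:
  assumes "\<alpha> < 1" "\<theta> > - \<alpha>"
  shows "box_moment \<alpha> \<theta> c s \<ge> 0"
  unfolding box_moment_def using assms
  by (intro divide_nonneg_nonneg mult_nonneg_nonneg pochhammer_nonneg) auto

lemma sum_list_minus_const:
  "(\<Sum>l\<leftarrow>ms. real l - \<alpha>) = real (sum_list ms) - real (length ms) * \<alpha>"
  by (induction ms) (auto simp: algebra_simps)

lemma sum_list_ge_length:
  fixes ms :: "nat list"
  assumes "\<forall>m\<in>set ms. m > 0"
  shows "length ms \<le> sum_list ms"
  using assms by (induction ms) force+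

text \<open>Nonempty blocks have size at least \<open>1 > \<alpha>\<close>, so the denominators of the biased picks are positive.\<close>

lemma total_weight_pos:
  assumes "0 \<le> \<alpha>" "\<alpha> < 1" "\<forall>m\<in>set ms. m > 0" "ms \<noteq> []"
  shows "real (length ms) * \<alpha> < real (sum_list ms)"
proof -
  have "real (length ms) * \<alpha> < real (length ms)"
    using assms by simp
  also have "\<dots> \<le> real (sum_list ms)"
    using sum_list_ge_length[OF assms(3)] by simp
  finally show ?thesis .
qed

lemma eppf_Nil [simp]: "eppf \<alpha> \<theta> [] = 1"
  by (simp add: eppf_def)

lemma eppf_pos:
  assumes "0 \<le> \<alpha>" "\<alpha> < 1" "\<theta> > - \<alpha>"
  shows "eppf \<alpha> \<theta> ms > 0"
proof -
  have "\<theta> + real i * \<alpha> > 0" if "i \<in> {1..<length ms}" for i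
  proof -
    have "1 * \<alpha> \<le> real i * \<alpha>"
      using that assms by (intro mult_right_mono) auto
    then show ?thesis using assms by linarith
  qed
  moreover have "(\<Prod>m\<leftarrow>ms. pochhammer (1 - \<alpha>) (m - 1)) > 0"
    using assms by (induction ms) (auto intro!: mult_pos_pos pochhammer_pos)
  ultimately show ?thesis
    unfolding eppf_def using assms
    by (intro mult_pos_pos divide_pos_pos prod_pos pochhammer_pos) auto
qed

lemma eppf_mset_cong:
  assumes "mset ms = mset ns"
  shows "eppf \<alpha> \<theta> ms = eppf \<alpha> \<theta> ns"
proof -
  have "(\<Prod>m\<leftarrow>ms. pochhammer (1 - \<alpha>) (m - 1)) = (\<Prod>m\<leftarrow>ns. pochhammer (1 - \<alpha>) (m - 1))"
    using assms by (metis mset_map prod_mset_prod_list)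
  moreover have "sum_list ms = sum_list ns"
    using assms by (metis sum_mset_sum_list)
  ultimately show ?thesis
    using mset_eq_length[OF assms] by (simp add: eppf_def)
qed

lemma pick_prob_pos:
  assumes "0 \<le> \<alpha>" "\<alpha> < 1" "\<forall>m\<in>set ms. m > 0"
  shows "pick_prob \<alpha> ms > 0"
  using assms(3)
proof (induction ms)
  case (Cons m ms)
  have "real m - \<alpha> > 0"
    using Cons.prems assms(2) by auto
  moreover have "(\<Sum>l\<leftarrow>m # ms. real l - \<alpha>) > 0"
    using total_weight_pos[OF assms(1,2) Cons.prems] unfolding sum_list_minus_const by auto
  ultimately show ?case
    using Cons by (simp del: sum_list.Cons list.map)
qed simp

definition ordered_eppf :: "real \<Rightarrow> real \<Rightarrow> nat list \<Rightarrow> real" where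
  "ordered_eppf \<alpha> \<theta> ms = eppf \<alpha> \<theta> ms * pick_prob \<alpha> ms"

lemma ordered_eppf_pos:
  assumes "0 \<le> \<alpha>" "\<alpha> < 1" "\<theta> > - \<alpha>" "\<forall>m\<in>set ms. m > 0"
  shows "ordered_eppf \<alpha> \<theta> ms > 0"
  unfolding ordered_eppf_def using assms by (intro mult_pos_pos eppf_pos pick_prob_pos)

text \<open>The numerators of the symmetric factor at \<open>\<theta>\<close> and at \<open>\<theta> + \<alpha>\<close> differ by one factor at each end.\<close>

lemma prod_shift:
  "(\<theta> + \<alpha>) * (\<Prod>i\<in>{1..<Suc k}. (\<theta> + \<alpha>) + real i * \<alpha>) = (\<Prod>i\<in>{1..<Suc (Suc k)}. \<theta> + real i * \<alpha>)"
  by (subst (2) prod.atLeast_Suc_lessThan, simp)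
     (subst prod.shift_bounds_Suc_ivl, simp add: algebra_simps)

lemma pochhammer_pred:
  assumes "n > 0"
  shows "pochhammer a n = pochhammer a (n - 1) * (a + real n - 1)"
  using assms by (cases n) (auto simp: pochhammer_Suc)

text \<open>Write \<open>n\<close> for the total size and \<open>k\<close> for the number of blocks.  Leaving the first box empty affects
  neither the picks nor the block factors; both rising factorials telescope, and what survives is
  \<open>(\<theta> + k\<alpha>) / (\<theta> + n)\<close>.\<close>

lemma empty_box_ordered_eppf:
  assumes "0 \<le> \<alpha>" "\<alpha> < 1" "\<theta> > - \<alpha>" "\<forall>m\<in>set ms. m > 0" "ms \<noteq> []"
  shows "box_moment \<alpha> \<theta> 0 (sum_list ms) * ordered_eppf \<alpha> (\<theta> + \<alpha>) ms =
    (\<theta> + real (length ms) * \<alpha>) / (\<theta> + real (sum_list ms)) * ordered_eppf \<alpha> \<theta> ms"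
proof -
  obtain k where k: "length ms = Suc k"
    using assms(5) by (cases ms) auto
  have "sum_list ms > 0"
    using assms(4,5) by (cases ms) auto
  then obtain n where n: "sum_list ms = Suc n"
    using gr0_implies_Suc by blast
  define A A' B B' where "A = (\<Prod>i\<in>{1..<length ms}. \<theta> + \<alpha> + real i * \<alpha>)"
    and "A' = (\<Prod>i\<in>{1..<length ms}. \<theta> + real i * \<alpha>)"
    and "B = pochhammer (\<theta> + \<alpha> + 1) n" and "B' = pochhammer (\<theta> + 1) n"
  have nz: "B > 0" "B' > 0" "\<theta> + 1 + real n > 0"
    using assms by (auto intro!: pochhammer_pos simp: B_def B'_def)
  have AA': "(\<theta> + \<alpha>) * A = A' * (\<theta> + real (length ms) * \<alpha>)"
    unfolding A_def A'_def k prod_shift by (simp add: algebra_simps)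
  have "box_moment \<alpha> \<theta> 0 (sum_list ms) = (\<theta> + \<alpha>) * B / (B' * (\<theta> + 1 + real n))"
    by (simp add: box_moment_def n B_def B'_def pochhammer_rec[of "\<theta> + \<alpha>"] pochhammer_Suc[of "\<theta> + 1"])
  then have "box_moment \<alpha> \<theta> 0 (sum_list ms) * (A / B) = (\<theta> + \<alpha>) * A / (B' * (\<theta> + 1 + real n))"
    using nz by simp
  also have "\<dots> = (\<theta> + real (length ms) * \<alpha>) / (\<theta> + real (sum_list ms)) * (A' / B')"
    unfolding AA' using nz by (simp add: n field_simps)
  finally have "box_moment \<alpha> \<theta> 0 (sum_list ms) * (A / B) * z =
      (\<theta> + real (length ms) * \<alpha>) / (\<theta> + real (sum_list ms)) * (A' / B') * z" for z
    by simp
  then show ?thesis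
    unfolding ordered_eppf_def eppf_def A_def A'_def B_def B'_def by (simp add: n mult.assoc)
qed

text \<open>The fraction left over by an empty first box is \<open>(n - k\<alpha>) / (\<theta> + n)\<close>.  Its numerator is the
  denominator of the first biased pick; this cancellation is where the bias by size minus \<open>\<alpha>\<close>
  comes from.\<close>

lemma full_box_ordered_eppf:
  assumes "0 \<le> \<alpha>" "\<alpha> < 1" "\<theta> > - \<alpha>" "\<forall>l\<in>set (m # ms). l > 0"
  shows "box_moment \<alpha> \<theta> m (sum_list ms) * ordered_eppf \<alpha> (\<theta> + \<alpha>) ms =
    (1 - (\<theta> + real (length (m # ms)) * \<alpha>) / (\<theta> + real (sum_list (m # ms)))) * ordered_eppf \<alpha> \<theta> (m # ms)"
proof -
  define n k where "n = sum_list (m # ms)" and "k = length (m # ms)"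
  have m: "m > 0" and nm: "n \<ge> m"
    using assms(4) by (auto simp: n_def)
  have n: "real n \<ge> 1"
    using m nm by simp
  define A A' B' where "A = (\<Prod>i\<in>{1..<length ms}. \<theta> + \<alpha> + real i * \<alpha>) / pochhammer (\<theta> + \<alpha> + 1) (sum_list ms - 1)"
    and "A' = (\<Prod>i\<in>{1..<k}. \<theta> + real i * \<alpha>)"
    and "B' = pochhammer (\<theta> + 1) (n - 1)"
  define W where "W = (\<Prod>l\<leftarrow>ms. pochhammer (1 - \<alpha>) (l - 1)) * pick_prob \<alpha> ms"
  have nz: "B' > 0" "\<theta> + real n > 0"
    using assms n by (auto intro!: pochhammer_pos simp: B'_def)
  have AA': "pochhammer (\<theta> + \<alpha>) (sum_list ms) * A = A'"
  proof (cases ms)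
    case Nil
    then show ?thesis by (simp add: A_def A'_def k_def)
  next
    case (Cons l ls)
    then obtain s where s: "sum_list ms = Suc s"
      using assms(4) gr0_implies_Suc by force
    have "pochhammer (\<theta> + \<alpha> + 1) s > 0"
      using assms by (intro pochhammer_pos) auto
    moreover have "A' = (\<theta> + \<alpha>) * (\<Prod>i\<in>{1..<length ms}. \<theta> + \<alpha> + real i * \<alpha>)"
      using prod_shift[of \<theta> \<alpha> "length ls"] unfolding A'_def k_def Cons by simp
    ultimately show ?thesis
      by (simp add: A_def s pochhammer_rec[of "\<theta> + \<alpha>"])
  qed
  have "real k * \<alpha> < real n"
    unfolding n_def k_def by (intro total_weight_pos assms) auto
  then have pp: "pick_prob \<alpha> (m # ms) * (real n - real k * \<alpha>) = (real m - \<alpha>) * pick_prob \<alpha> ms"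
    by (simp only: pick_prob.simps sum_list_minus_const flip: n_def k_def) simp
  have "box_moment \<alpha> \<theta> m (sum_list ms) = pochhammer (1 - \<alpha>) (m - 1) * (real m - \<alpha>) *
      pochhammer (\<theta> + \<alpha>) (sum_list ms) / (B' * (\<theta> + real n))"
  proof -
    have "pochhammer (1 - \<alpha>) m = pochhammer (1 - \<alpha>) (m - 1) * (real m - \<alpha>)"
      using pochhammer_pred[of m "1 - \<alpha>"] m by simp
    moreover have "pochhammer (\<theta> + 1) (m + sum_list ms) = B' * (\<theta> + real n)"
      using pochhammer_pred[of n "\<theta> + 1"] m nm by (simp add: B'_def n_def add_ac)
    ultimately show ?thesis
      by (simp add: box_moment_def)
  qed
  then have "box_moment \<alpha> \<theta> m (sum_list ms) * (A * W) = pochhammer (1 - \<alpha>) (m - 1) * (real m - \<alpha>) *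
      (pochhammer (\<theta> + \<alpha>) (sum_list ms) * A) * W / (B' * (\<theta> + real n))"
    by simp
  also have "\<dots> = pochhammer (1 - \<alpha>) (m - 1) * A' * (\<Prod>l\<leftarrow>ms. pochhammer (1 - \<alpha>) (l - 1)) *
      (pick_prob \<alpha> (m # ms) * (real n - real k * \<alpha>)) / (B' * (\<theta> + real n))"
    unfolding AA' pp W_def by (simp del: pick_prob.simps)
  also have "\<dots> = (1 - (\<theta> + real k * \<alpha>) / (\<theta> + real n)) *
     (A' / B' * (pochhammer (1 - \<alpha>) (m - 1) * (\<Prod>l\<leftarrow>ms. pochhammer (1 - \<alpha>) (l - 1))) * pick_prob \<alpha> (m # ms))"
    using nz by (simp add: field_simps del: pick_prob.simps)
  finally show ?thesis
    unfolding ordered_eppf_def eppf_def W_def A_def A'_def B'_def n_def k_def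
    by (simp add: mult.assoc del: pick_prob.simps)
qed

text \<open>Each factor is \<open>1 - (N - k) / (N + j\<alpha>)\<close>, at most \<open>exp (- c / (j + 1))\<close> because \<open>\<alpha> \<le> 1\<close>, and the
  harmonic series diverges.\<close>

lemma prod_ratio_tendsto_0:
  fixes \<alpha> :: real and N k x :: real
  assumes "0 \<le> \<alpha>" "\<alpha> \<le> 1" "0 < N - k" "0 < k"
  shows "(\<lambda>J. \<Prod>j<J. (k + real j * \<alpha>) / (N + real j * \<alpha>)) \<longlonglongrightarrow> 0"
proof -
  define c where "c = (N - k) / (N + 1)"
  have c: "c > 0" using assms by (simp add: c_def)
  have factor: "(k + real j * \<alpha>) / (N + real j * \<alpha>) \<le> exp (- (c / real (Suc j)))" for j
  proof -
    have pos: "N + real j * \<alpha> > 0"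
      using assms by (intro add_pos_nonneg) auto
    have "N + real j * \<alpha> \<le> N + real j * 1"
      using assms by (intro add_left_mono mult_left_mono) auto
    also have "\<dots> \<le> (N + 1) * real (Suc j)"
      using assms by (simp add: algebra_simps)
    finally have "(N - k) / ((N + 1) * real (Suc j)) \<le> (N - k) / (N + real j * \<alpha>)"
      using assms pos by (intro divide_left_mono) auto
    then have "1 + - ((N - k) / (N + real j * \<alpha>)) \<le> 1 + - (c / real (Suc j))"
      by (simp add: c_def)
    also have "\<dots> \<le> exp (- (c / real (Suc j)))"
      by (rule exp_ge_add_one_self)
    finally show ?thesis
      using pos by (simp add: field_simps)
  qed
  have "filterlim (\<lambda>J. \<Sum>j<J. 1 / real (Suc j)) at_top sequentially"
    using harm_at_top unfolding harm_altdef[abs_def] by (simp add: inverse_eq_divide)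
  then have "filterlim (\<lambda>J. c * (\<Sum>j<J. 1 / real (Suc j))) at_top sequentially"
    using c by (intro filterlim_tendsto_pos_mult_at_top[OF tendsto_const])
  then have lim: "(\<lambda>J. exp (- (c * (\<Sum>j<J. 1 / real (Suc j))))) \<longlonglongrightarrow> 0"
    by (intro filterlim_compose[OF exp_at_bot] filterlim_compose[OF filterlim_uminus_at_bot_at_top])
  show ?thesis
  proof (rule tendsto_sandwich[OF _ _ tendsto_const lim]; intro always_eventually allI)
    fix J
    show "0 \<le> (\<Prod>j<J. (k + real j * \<alpha>) / (N + real j * \<alpha>))"
      using assms by (intro prod_nonneg) auto
    have "(\<Prod>j<J. (k + real j * \<alpha>) / (N + real j * \<alpha>)) \<le> (\<Prod>j<J. exp (- (c / real (Suc j))))"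
      using assms by (intro prod_mono conjI factor) auto
    then show "(\<Prod>j<J. (k + real j * \<alpha>) / (N + real j * \<alpha>)) \<le> exp (- (c * (\<Sum>j<J. 1 / real (Suc j))))"
      by (simp add: exp_sum sum_distrib_left flip: sum_negf)
  qed
qed

lemma padded_sum_nonneg:
  assumes "\<alpha> < 1" "0 \<le> \<alpha>" "\<theta> > - \<alpha>"
  shows "padded_sum \<alpha> \<theta> Cs L \<ge> 0"
proof -
  have "boxes_prob \<alpha> \<theta> cs \<ge> 0" for cs
    using assms by (induction cs arbitrary: \<theta>) (auto intro!: mult_nonneg_nonneg box_moment_nonneg)
  then show ?thesis
    unfolding padded_sum_def by (intro sum_nonneg)
qed

lemma cards_pos:
  assumes "\<forall>C\<in>set Cs. finite C \<and> C \<noteq> {}"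
  shows "\<forall>m\<in>set (map card Cs). m > 0"
  using assms by (auto simp: card_gt_0_iff)

text \<open>The closed form solves the recursion with nonnegative coefficients, and the sums over finitely many
  boxes start below it.\<close>

lemma padded_sum_le:
  assumes "0 \<le> \<alpha>" "\<alpha> < 1" "\<theta> > - \<alpha>" "\<forall>C\<in>set Cs. finite C \<and> C \<noteq> {}"
  shows "padded_sum \<alpha> \<theta> Cs L \<le> ordered_eppf \<alpha> \<theta> (map card Cs)"
  using assms(3,4)
proof (induction L arbitrary: Cs \<theta>)
  case 0
  then show ?case
    using ordered_eppf_pos[OF assms(1,2) 0(1) cards_pos[OF 0(2)]]
    by (cases Cs) (simp_all add: padded_sum_Nil padded_sum_0_Cons ordered_eppf_def)
next
  case (Suc L)
  show ?case
  proof (cases Cs)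
    case Nil
    then show ?thesis by (simp add: padded_sum_Nil ordered_eppf_def)
  next
    case (Cons C Ds)
    have \<theta>: "\<theta> + \<alpha> > - \<alpha>"
      using Suc.prems assms by auto
    have "padded_sum \<alpha> \<theta> (C # Ds) (Suc L) \<le>
      box_moment \<alpha> \<theta> (card C) (sum_list (map card Ds)) * ordered_eppf \<alpha> (\<theta> + \<alpha>) (map card Ds) +
      box_moment \<alpha> \<theta> 0 (sum_list (map card (C # Ds))) * ordered_eppf \<alpha> (\<theta> + \<alpha>) (map card (C # Ds))"
      using Suc.prems assms Cons \<theta>
      by (subst padded_sum_Suc_Cons) (auto intro!: add_mono mult_left_mono box_moment_nonneg Suc.IH simp del: list.map)
    also have "\<dots> = ordered_eppf \<alpha> \<theta> (map card Cs)"
      using full_box_ordered_eppf[OF assms(1,2) Suc.prems(1), of "card C" "map card Ds"]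
        empty_box_ordered_eppf[OF assms(1,2) Suc.prems(1), of "map card Cs"] cards_pos[OF Suc.prems(2)]
      by (simp add: Cons algebra_simps)
    finally show ?thesis using Cons by simp
  qed
qed

text \<open>By induction on the blocks.  The relative error \<open>R \<theta> L\<close> for \<open>L\<close> boxes satisfies
  \<open>R \<theta> (L + 1) = (1 - q \<theta>) e (\<theta> + \<alpha>) L + q \<theta> R (\<theta> + \<alpha>) L\<close>, where \<open>e\<close> is the relative error for the
  tail of the list, which vanishes in the limit by the induction hypothesis.  Unrolling \<open>J\<close> times leaves
  a vanishing term and at most the product of \<open>J\<close> values of \<open>q\<close>.\<close>

lemma padded_sum_tendsto:
  assumes "0 \<le> \<alpha>" "\<alpha> < 1" "\<theta> > - \<alpha>" "\<forall>C\<in>set Cs. finite C \<and> C \<noteq> {}"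
  shows "padded_sum \<alpha> \<theta> Cs \<longlonglongrightarrow> ordered_eppf \<alpha> \<theta> (map card Cs)"
  using assms(3,4)
proof (induction Cs arbitrary: \<theta>)
  case Nil
  then show ?case
    by (simp add: padded_sum_Nil[abs_def] ordered_eppf_def)
next
  case (Cons C Cs \<theta>)
  define n k where "n = real (sum_list (map card (C # Cs)))" and "k = real (length (C # Cs))"
  define G where "G \<theta> = ordered_eppf \<alpha> \<theta> (map card (C # Cs))" for \<theta>
  define R where "R \<theta> L = 1 - padded_sum \<alpha> \<theta> (C # Cs) L / G \<theta>" for \<theta> L
  have k: "k \<ge> 1" "k * \<alpha> < n"
    using total_weight_pos[OF assms(1,2) cards_pos[OF Cons.prems(2)]]
    unfolding n_def k_def by simp_all
  have G: "G \<theta> > 0" if "\<theta> > - \<alpha>" for \<theta>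
    unfolding G_def using assms cards_pos[OF Cons.prems(2)] that by (intro ordered_eppf_pos)
  have R_bounds: "R \<theta> L \<in> {0..1}" if "\<theta> > - \<alpha>" for \<theta> L
    using padded_sum_le[OF assms(1,2) that Cons.prems(2), of L]
      padded_sum_nonneg[OF assms(2,1) that, of "C # Cs" L] G[OF that]
    by (simp add: R_def G_def field_simps)
  define q where "q \<theta> = (\<theta> + k * \<alpha>) / (\<theta> + n)" for \<theta>
  define e where "e \<theta> L = 1 - padded_sum \<alpha> \<theta> Cs L / ordered_eppf \<alpha> \<theta> (map card Cs)" for \<theta> L
  have q: "q \<theta> \<in> {0..1}" if "\<theta> > - \<alpha>" for \<theta>
  proof -
    have "1 * \<alpha> \<le> k * \<alpha>"
      using k assms by (intro mult_right_mono) auto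
    then show ?thesis
      using k that by (auto simp: q_def field_simps)
  qed
  have e_lim: "e \<theta> \<longlonglongrightarrow> 0" if "\<theta> > - \<alpha>" for \<theta>
  proof -
    have "ordered_eppf \<alpha> \<theta> (map card Cs) > 0"
      using assms cards_pos[OF Cons.prems(2)] that by (intro ordered_eppf_pos) auto
    then have "e \<theta> \<longlonglongrightarrow> 1 - ordered_eppf \<alpha> \<theta> (map card Cs) / ordered_eppf \<alpha> \<theta> (map card Cs)"
      unfolding e_def using Cons.IH[OF that] Cons.prems(2) by (intro tendsto_intros) auto
    then show ?thesis
      using \<open>ordered_eppf \<alpha> \<theta> (map card Cs) > 0\<close> by simp
  qed
  have R_Suc: "R \<theta> (Suc L) = (1 - q \<theta>) * e (\<theta> + \<alpha>) L + q \<theta> * R (\<theta> + \<alpha>) L"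
    if "\<theta> > - \<alpha>" for \<theta> L
  proof -
    have \<theta>: "\<theta> + \<alpha> > - \<alpha>" using that assms by simp
    have g: "ordered_eppf \<alpha> (\<theta> + \<alpha>) (map card Cs) > 0"
      using assms cards_pos[OF Cons.prems(2)] \<theta> by (intro ordered_eppf_pos) auto
    have full: "box_moment \<alpha> \<theta> (card C) (sum_list (map card Cs)) =
        (1 - q \<theta>) * G \<theta> / ordered_eppf \<alpha> (\<theta> + \<alpha>) (map card Cs)"
      using full_box_ordered_eppf[OF assms(1,2) that, of "card C" "map card Cs"] cards_pos[OF Cons.prems(2)] g
      by (simp add: q_def n_def k_def G_def field_simps)
    have empty: "box_moment \<alpha> \<theta> 0 (sum_list (map card (C # Cs))) = q \<theta> * G \<theta> / G (\<theta> + \<alpha>)"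
    proof -
      have "box_moment \<alpha> \<theta> 0 (sum_list (map card (C # Cs))) * G (\<theta> + \<alpha>) = q \<theta> * G \<theta>"
        using empty_box_ordered_eppf[OF assms(1,2) that cards_pos[OF Cons.prems(2)]]
        by (simp add: q_def n_def k_def G_def)
      then show ?thesis
        using G[OF \<theta>] by (simp add: eq_divide_eq)
    qed
    have "padded_sum \<alpha> \<theta> (C # Cs) (Suc L) =
        (1 - q \<theta>) * G \<theta> * (padded_sum \<alpha> (\<theta> + \<alpha>) Cs L / ordered_eppf \<alpha> (\<theta> + \<alpha>) (map card Cs)) +
        q \<theta> * G \<theta> * (padded_sum \<alpha> (\<theta> + \<alpha>) (C # Cs) L / G (\<theta> + \<alpha>))"
      using Cons.prems(2)
      by (subst padded_sum_Suc_Cons) (simp_all only: full empty times_divide_eq_left times_divide_eq_right, blast)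
    also have "\<dots> = G \<theta> * (1 - ((1 - q \<theta>) * e (\<theta> + \<alpha>) L + q \<theta> * R (\<theta> + \<alpha>) L))"
      by (simp add: e_def R_def algebra_simps)
    finally show ?thesis
      using G[OF that] by (simp add: R_def)
  qed
  have step: "\<exists>\<epsilon>. \<epsilon> \<longlonglongrightarrow> 0 \<and> (\<forall>L. R \<theta> (L + J) \<le> \<epsilon> L + (\<Prod>j<J. q (\<theta> + real j * \<alpha>)))"
    if "\<theta> > - \<alpha>" for \<theta> J
    using that
  proof (induction J arbitrary: \<theta>)
    case 0
    then show ?case
      using R_bounds by (intro exI[of _ "\<lambda>_. 0"]) auto
  next
    case (Suc J \<theta>)
    have \<theta>: "\<theta> + \<alpha> > - \<alpha>" using Suc.prems assms by simp
    obtain \<epsilon> where \<epsilon>: "\<epsilon> \<longlonglongrightarrow> 0"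
      "\<And>L. R (\<theta> + \<alpha>) (L + J) \<le> \<epsilon> L + (\<Prod>j<J. q (\<theta> + \<alpha> + real j * \<alpha>))"
      using Suc.IH[OF \<theta>] by blast
    define \<epsilon>' where "\<epsilon>' L = (1 - q \<theta>) * e (\<theta> + \<alpha>) (L + J) + q \<theta> * \<epsilon> L" for L
    have "\<epsilon>' \<longlonglongrightarrow> (1 - q \<theta>) * 0 + q \<theta> * 0"
      unfolding \<epsilon>'_def by (intro tendsto_intros LIMSEQ_ignore_initial_segment e_lim \<theta> \<epsilon>)
    moreover have "R \<theta> (L + Suc J) \<le> \<epsilon>' L + (\<Prod>j<Suc J. q (\<theta> + real j * \<alpha>))" for L
    proof -
      have "q \<theta> * R (\<theta> + \<alpha>) (L + J) \<le> q \<theta> * (\<epsilon> L + (\<Prod>j<J. q (\<theta> + \<alpha> + real j * \<alpha>)))"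
        using q[OF Suc.prems] \<epsilon>(2) by (intro mult_left_mono) auto
      moreover have "(\<Prod>j<Suc J. q (\<theta> + real j * \<alpha>)) = q \<theta> * (\<Prod>j<J. q (\<theta> + \<alpha> + real j * \<alpha>))"
        by (subst prod.lessThan_Suc_shift) (simp add: algebra_simps)
      ultimately show ?thesis
        using R_Suc[OF Suc.prems, of "L + J"] by (simp add: \<epsilon>'_def algebra_simps)
    qed
    ultimately show ?case by auto
  qed
  have "R \<theta> \<longlonglongrightarrow> 0"
  proof (rule LIMSEQ_I)
    fix r :: real assume r: "r > 0"
    have "1 * \<alpha> \<le> k * \<alpha>"
      using k assms by (intro mult_right_mono) auto
    then have "(\<lambda>J. \<Prod>j<J. (\<theta> + k * \<alpha> + real j * \<alpha>) / (\<theta> + n + real j * \<alpha>)) \<longlonglongrightarrow> 0"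
      using assms k Cons.prems by (intro prod_ratio_tendsto_0) auto
    then have "(\<lambda>J. \<Prod>j<J. q (\<theta> + real j * \<alpha>)) \<longlonglongrightarrow> 0"
      by (simp add: q_def algebra_simps)
    then obtain J where J: "(\<Prod>j<J. q (\<theta> + real j * \<alpha>)) < r / 2"
      using r order_tendstoD(2)[of _ 0 sequentially "r / 2"] eventually_happens by fastforce
    obtain \<epsilon> where \<epsilon>: "\<epsilon> \<longlonglongrightarrow> 0" "\<And>L. R \<theta> (L + J) \<le> \<epsilon> L + (\<Prod>j<J. q (\<theta> + real j * \<alpha>))"
      using step[OF Cons.prems(1)] by blast
    then obtain L0 where L0: "\<And>L. L \<ge> L0 \<Longrightarrow> \<epsilon> L < r / 2"
      using r order_tendstoD(2)[OF \<epsilon>(1), of "r / 2"] by (auto simp: eventually_sequentially)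
    have "norm (R \<theta> L - 0) < r" if "L \<ge> L0 + J" for L
    proof -
      have "L0 \<le> L - J" "L - J + J = L"
        using that by simp_all
      then have "R \<theta> L < r"
        using J \<epsilon>(2)[of "L - J"] L0[of "L - J"] by simp
      then show ?thesis
        using R_bounds[OF Cons.prems(1), of L] by simp
    qed
    then show "\<exists>no. \<forall>L\<ge>no. norm (R \<theta> L - 0) < r" by blast
  qed
  then have "(\<lambda>L. G \<theta> * (1 - R \<theta> L)) \<longlonglongrightarrow> G \<theta> * (1 - 0)"
    by (intro tendsto_intros)
  then show ?case
    using G[OF Cons.prems(1)] by (simp add: R_def G_def)
qed

section \<open>Successive biased picks\<close>

lemma Cons_in_permutations_of_set_iff:
  "j # js \<in> permutations_of_set S \<longleftrightarrow> j \<in> S \<and> js \<in> permutations_of_set (S - {j})"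
  by (auto simp: permutations_of_set_def)

lemma pmf_map_Cons:
  "pmf (map_pmf (Cons i) p) (j # js) = (if i = j then pmf p js else 0)"
proof (cases "i = j")
  case False
  then have "j # js \<notin> set_pmf (map_pmf (Cons i) p)"
    by auto
  then show ?thesis
    using False by (simp add: pmf_eq_0_set_pmf)
qed (simp add: pmf_map_inj')

lemma pmf_biased_picks:
  assumes "\<alpha> < 1" "finite S" "\<And>i. i \<in> S \<Longrightarrow> ns ! i > 0"
  shows "pmf (biased_picks \<alpha> ns S (card S)) is =
    (if is \<in> permutations_of_set S then pick_prob \<alpha> (map ((!) ns) is) else 0)"
  using assms(2,3)
proof (induction "card S" arbitrary: S "is")
  case 0
  then show ?case by (auto simp: pmf_eq_0_set_pmf)
next
  case (Suc m)
  have ne: "S \<noteq> {}"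
    using Suc.hyps(2) by auto
  have IH: "pmf (biased_picks \<alpha> ns (S - {i}) m) js =
      (if js \<in> permutations_of_set (S - {i}) then pick_prob \<alpha> (map ((!) ns) js) else 0)"
    if "i \<in> S" for i js
  proof -
    have "card (S - {i}) = m"
      using Suc.hyps(2) Suc.prems(1) that by simp
    then show ?thesis
      using Suc.hyps(1)[of "S - {i}" js] Suc.prems by simp
  qed
  have pick: "pmf (biased_pick \<alpha> ns S) i =
      (if i \<in> S then (real (ns ! i) - \<alpha>) / (\<Sum>j\<in>S. real (ns ! j) - \<alpha>) else 0)" for i
    using assms(1) Suc.prems ne by (intro pmf_biased_pick)
  have "set_pmf (biased_pick \<alpha> ns S) \<subseteq> S"
    by (auto simp: set_pmf_iff pick split: if_splits)
  then have sum: "pmf (biased_picks \<alpha> ns S (card S)) is =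
      (\<Sum>i\<in>S. pmf (biased_pick \<alpha> ns S) i *
        pmf (map_pmf (Cons i) (biased_picks \<alpha> ns (S - {i}) m)) is)"
    unfolding Suc.hyps(2)[symmetric] biased_picks.simps pmf_bind
    using Suc.prems by (subst integral_measure_pmf[of S]) auto
  show ?case
  proof (cases "is")
    case Nil
    then have "pmf (map_pmf (Cons i) p) is = 0" for i and p :: "nat list pmf"
      by (auto simp: pmf_eq_0_set_pmf)
    then show ?thesis
      unfolding sum using Nil ne by (auto simp: permutations_of_set_def)
  next
    case (Cons j js)
    \<comment> \<open>Only the pick \<open>i = j\<close> can start the list \<open>j # js\<close>.\<close>
    have "pmf (biased_picks \<alpha> ns S (card S)) is =
      (\<Sum>i\<in>S. if i = j then pmf (biased_pick \<alpha> ns S) j * pmf (biased_picks \<alpha> ns (S - {j}) m) js else 0)"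
      unfolding sum unfolding Cons pmf_map_Cons by (intro sum.cong) auto
    also have "\<dots> = (if j \<in> S then pmf (biased_pick \<alpha> ns S) j * pmf (biased_picks \<alpha> ns (S - {j}) m) js else 0)"
      using Suc.prems by simp
    also have "\<dots> = (if is \<in> permutations_of_set S then pick_prob \<alpha> (map ((!) ns) is) else 0)"
    proof (cases "is \<in> permutations_of_set S")
      case True
      then have "(\<Sum>l\<leftarrow>map ((!) ns) is. real l - \<alpha>) = (\<Sum>j\<in>S. real (ns ! j) - \<alpha>)"
        by (auto simp: permutations_of_set_def sum_list_distinct_conv_sum_set o_def)
      then show ?thesis
        using True unfolding Cons Cons_in_permutations_of_set_iff by (simp add: pick IH)
    next
      case False
      then show ?thesis
        unfolding Cons Cons_in_permutations_of_set_iff by (auto simp: IH)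
    qed
    finally show ?thesis .
  qed
qed

text \<open>Different orders of the blocks may show the same list of sizes, whence the count; a permutation of
  indices is the same thing as an ordering of the blocks because \<open>Bs\<close> is distinct.\<close>

lemma pmf_size_biased_permutation:
  assumes "\<alpha> < 1" "distinct Bs" "\<forall>B\<in>set Bs. finite B \<and> B \<noteq> {}"
  shows "pmf (size_biased_permutation \<alpha> (map card Bs)) ms =
    real (card {Cs \<in> permutations_of_set (set Bs). map card Cs = ms}) * pick_prob \<alpha> ms"
proof -
  define k ns S where "k = length Bs" and "ns = map card Bs" and "S = {..<k}"
  define p where "p = biased_picks \<alpha> ns S (card S)"
  define T where "T = {is \<in> permutations_of_set S. map ((!) ns) is = ms}"
  have pos: "ns ! i > 0" if "i \<in> S" for i
    using assms(3) that by (auto simp: ns_def S_def k_def card_gt_0_iff)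
  have pmf_p: "pmf p is = (if is \<in> permutations_of_set S then pick_prob \<alpha> (map ((!) ns) is) else 0)" for "is"
    unfolding p_def using assms(1) pos by (intro pmf_biased_picks) (auto simp: S_def)
  have "pmf (size_biased_permutation \<alpha> ns) ms = pmf (map_pmf (map ((!) ns)) p) ms"
    by (simp add: size_biased_permutation_def p_def S_def k_def ns_def)
  also have "\<dots> = measure p (map ((!) ns) -` {ms})"
    by (rule pmf_map)
  also have "\<dots> = measure p T"
    by (intro measure_prob_cong_0) (auto simp: T_def pmf_p)
  also have "\<dots> = sum (pmf p) T"
    by (intro measure_measure_pmf_finite) (auto simp: T_def)
  also have "\<dots> = (\<Sum>is\<in>T. pick_prob \<alpha> ms)"
    by (intro sum.cong refl) (auto simp: T_def pmf_p)
  also have "\<dots> = real (card T) * pick_prob \<alpha> ms"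
    by simp
  also have "card T = card (map ((!) Bs) ` T)"
  proof (rule card_image[symmetric])
    have "inj_on ((!) Bs) S"
      using assms(2) by (auto simp: inj_on_def S_def k_def nth_eq_iff_index_eq)
    then show "inj_on (map ((!) Bs)) T"
      by (auto simp: inj_on_def T_def permutations_of_set_def dest!: map_inj_on)
  qed
  also have "map ((!) Bs) ` T = {Cs \<in> permutations_of_set (set Bs). map card Cs = ms}"
  proof -
    have "set Bs = (!) Bs ` S"
      by (auto simp: S_def k_def in_set_conv_nth)
    moreover have "inj_on ((!) Bs) S"
      using assms(2) by (auto simp: inj_on_def S_def k_def nth_eq_iff_index_eq)
    ultimately have "permutations_of_set (set Bs) = map ((!) Bs) ` permutations_of_set S"
      by (simp add: permutations_of_set_image_inj)
    moreover have "map card (map ((!) Bs) is) = map ((!) ns) is" if "is \<in> permutations_of_set S" for "is"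
      using that by (auto simp: permutations_of_set_def ns_def S_def k_def)
    ultimately show ?thesis
      by (auto simp: T_def)
  qed
  finally show ?thesis
    by (simp add: ns_def)
qed

text \<open>Summing over the orders of a fixed set of blocks that show the sizes \<open>ms\<close>, the symmetric factor comes
  out of the sum, and the biased permutation remains.\<close>

lemma card_orderings_times_ordered_eppf:
  assumes "\<alpha> < 1" "distinct Bs" "\<forall>B\<in>set Bs. finite B \<and> B \<noteq> {}"
  shows "real (card {Cs \<in> permutations_of_set (set Bs). map card Cs = ms}) * ordered_eppf \<alpha> \<theta> ms =
    eppf \<alpha> \<theta> (map card Bs) * pmf (size_biased_permutation \<alpha> (map card Bs)) ms"
proof (cases "{Cs \<in> permutations_of_set (set Bs). map card Cs = ms} = {}")
  case False
  then obtain Cs where "Cs \<in> permutations_of_set (set Bs)" "map card Cs = ms"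
    by blast
  then have "mset ms = mset (map card Bs)"
    using assms(2) by (auto simp: permutations_of_set_def set_eq_iff_mset_eq_distinct)
  then show ?thesis
    by (simp add: pmf_size_biased_permutation[OF assms] ordered_eppf_def eppf_mset_cong[of ms "map card Bs"])
qed (simp add: pmf_size_biased_permutation[OF assms] del: Collect_empty_eq)

section \<open>Clusters as nonempty boxes\<close>

definition cell :: "nat \<Rightarrow> (nat \<Rightarrow> nat) \<Rightarrow> nat \<Rightarrow> nat set" where
  "cell n x j = {i \<in> {1..n}. x i = j}"

definition ordered_clusters :: "nat \<Rightarrow> (nat \<Rightarrow> nat) \<Rightarrow> nat set list" where
  "ordered_clusters n x = sorted_key_list_of_set (cluster_value x) (clusters n x)"

lemma clusters_eq_cells: "clusters n x = cell n x ` x ` {1..n}"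
proof -
  have "{(i, j). i \<in> {1..n} \<and> j \<in> {1..n} \<and> x i = x j} `` {i} = cell n x (x i)" if "i \<in> {1..n}" for i
    using that by (auto simp: cell_def)
  then show ?thesis
    by (auto simp: clusters_def quotient_def simp del: atLeastAtMost_iff)
qed

lemma cluster_value_cell:
  assumes "j \<in> x ` {1..n}"
  shows "cluster_value x (cell n x j) = j"
proof -
  have "x ` cell n x j = {j}"
    using assms by (auto simp: cell_def)
  then show ?thesis by (simp add: cluster_value_def)
qed

lemma partition_on_clusters: "partition_on {1..n} (clusters n x)"
  unfolding clusters_def
  by (rule partition_on_quotient) (auto simp: equiv_def refl_on_def sym_def trans_def)

text \<open>The locale \<open>folding_insort_key\<close> is interpreted inside the class context so that its constants are
  those of the class.\<close>

lemma (in linorder) sorted_key_list_of_set_eqI: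
  assumes "sorted_wrt (<) (map f l)"
  shows "sorted_key_list_of_set f (set l) = l"
proof -
  have "sorted (map f l)" "distinct (map f l)"
    using assms by (simp_all add: strict_sorted_iff)
  then interpret folding_insort_key "(\<le>)" "(<)" "set l" f
    by unfold_locales (simp add: distinct_map)
  show ?thesis
    using \<open>sorted (map f l)\<close> \<open>distinct (map f l)\<close>
    by (intro idem_if_sorted_distinct) (auto simp: distinct_map)
qed

lemma (in linorder) sorted_key_list_of_set_lists:
  assumes "inj_on f A" "finite A"
  shows "set (sorted_key_list_of_set f A) = A" "distinct (sorted_key_list_of_set f A)"
proof -
  interpret folding_insort_key "(\<le>)" "(<)" A f
    by unfold_locales (rule assms(1))
  show "set (sorted_key_list_of_set f A) = A" "distinct (sorted_key_list_of_set f A)"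
    using set_sorted_key_list_of_set[of A] distinct_sorted_key_list_of_set[of A] assms(2)
    by (auto simp: distinct_map)
qed

lemma ordered_clusters_eq_cells:
  "ordered_clusters n x = map (cell n x) (sorted_list_of_set (x ` {1..n}))"
proof -
  let ?l = "map (cell n x) (sorted_list_of_set (x ` {1..n}))"
  have "map (cluster_value x) ?l = map (\<lambda>j. j) (sorted_list_of_set (x ` {1..n}))"
    unfolding map_map by (intro map_cong refl) (auto simp: cluster_value_cell simp del: atLeastAtMost_iff)
  moreover have "clusters n x = set ?l"
    by (simp add: clusters_eq_cells)
  ultimately show ?thesis
    unfolding ordered_clusters_def by (metis list.map_ident sorted_key_list_of_set_eqI strict_sorted_list_of_set)
qed

lemma set_ordered_clusters: "set (ordered_clusters n x) = clusters n x"
  by (simp add: ordered_clusters_eq_cells clusters_eq_cells)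

text \<open>Reading the boxes in order and skipping the empty ones lists the clusters by value.\<close>

lemma ordered_clusters_conv_filter:
  assumes "x ` {1..n} \<subseteq> {1..L}"
  shows "ordered_clusters n x = filter (\<lambda>D. D \<noteq> {}) (map (cell n x) [1..<Suc L])"
proof -
  have "cell n x j \<noteq> {} \<longleftrightarrow> j \<in> x ` {1..n}" for j
    by (auto simp: cell_def)
  then have "filter (\<lambda>D. D \<noteq> {}) (map (cell n x) [1..<Suc L]) =
      map (cell n x) (filter (\<lambda>j. j \<in> x ` {1..n}) [1..<Suc L])"
    by (simp add: filter_map o_def)
  also have "filter (\<lambda>j. j \<in> x ` {1..n}) [1..<Suc L] = sorted_list_of_set (x ` {1..n})"
    using assms
    by (intro sorted_distinct_set_unique) (auto simp: sorted_wrt_filter simp del: upt_Suc)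
  finally show ?thesis
    by (simp add: ordered_clusters_eq_cells)
qed

lemma distinct_ordered_clusters: "distinct (ordered_clusters n x)"
proof -
  have "inj_on (cell n x) (x ` {1..n})"
    by (metis cluster_value_cell inj_onI)
  then show ?thesis
    by (simp add: ordered_clusters_eq_cells distinct_map)
qed

definition ordered_partitions :: "'b set \<Rightarrow> 'b set list set" where
  "ordered_partitions A = {Cs. distinct Cs \<and> partition_on A (set Cs)}"

lemma ordered_clusters_in_ordered_partitions:
  "ordered_clusters n x \<in> ordered_partitions {1..n}"
  unfolding ordered_partitions_def mem_Collect_eq set_ordered_clusters
  by (intro conjI distinct_ordered_clusters partition_on_clusters)

text \<open>Empty sets are disjoint from everything, so removing or adding them preserves pairwise disjointness.
  Unlike distinctness, this formulation applies to lists in which empty sets repeat.\<close>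

lemma sorted_wrt_disjnt_filter:
  "sorted_wrt disjnt (filter (\<lambda>D. D \<noteq> {}) Ds) \<longleftrightarrow> sorted_wrt disjnt Ds"
  by (induction Ds) auto

text \<open>A sample with values in \<open>{1..L}\<close> is determined by the contents of its boxes, and disjoint boxes that
  cover \<open>{1..n}\<close> come from a sample.\<close>

lemma bij_betw_samples_paddings:
  assumes "Cs \<in> ordered_partitions {1..n}"
  shows "bij_betw (\<lambda>x. map (cell n x) [1..<Suc L])
    {x \<in> {1..n} \<rightarrow>\<^sub>E {1..L}. ordered_clusters n x = Cs} (paddings L Cs)"
proof (rule bij_betw_imageI)
  show "inj_on (\<lambda>x. map (cell n x) [1..<Suc L]) {x \<in> {1..n} \<rightarrow>\<^sub>E {1..L}. ordered_clusters n x = Cs}"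
  proof (rule inj_onI)
    fix x y assume x: "x \<in> {x \<in> {1..n} \<rightarrow>\<^sub>E {1..L}. ordered_clusters n x = Cs}"
      and y: "y \<in> {x \<in> {1..n} \<rightarrow>\<^sub>E {1..L}. ordered_clusters n x = Cs}"
      and eq: "map (cell n x) [1..<Suc L] = map (cell n y) [1..<Suc L]"
    have "x i = y i" if "i \<in> {1..n}" for i
    proof -
      have "x i \<in> {1..L}"
        using x that by auto
      then have "cell n x (x i) = cell n y (x i)"
        using eq by auto
      moreover have "i \<in> cell n x (x i)"
        using that by (simp add: cell_def)
      ultimately show ?thesis
        by (simp add: cell_def)
    qed
    then show "x = y"
      using x y by (intro PiE_ext[of x "{1..n}" "\<lambda>_. {1..L}" y]) auto
  qed
  show "(\<lambda>x. map (cell n x) [1..<Suc L]) ` {x \<in> {1..n} \<rightarrow>\<^sub>E {1..L}. ordered_clusters n x = Cs} = paddings L Cs"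
  proof (intro equalityI subsetI)
    fix Ds assume "Ds \<in> (\<lambda>x. map (cell n x) [1..<Suc L]) ` {x \<in> {1..n} \<rightarrow>\<^sub>E {1..L}. ordered_clusters n x = Cs}"
    then obtain x where x: "x \<in> {1..n} \<rightarrow>\<^sub>E {1..L}" "ordered_clusters n x = Cs"
      and Ds: "Ds = map (cell n x) [1..<Suc L]" by blast
    have "x ` {1..n} \<subseteq> {1..L}"
      using x(1) by auto
    then show "Ds \<in> paddings L Cs"
      using x(2) ordered_clusters_conv_filter[of x n L] by (simp add: paddings_def Ds)
  next
    fix Ds assume "Ds \<in> paddings L Cs"
    then have len: "length Ds = L" and Cs: "filter (\<lambda>D. D \<noteq> {}) Ds = Cs"
      by (auto simp: paddings_def)
    have "sorted_wrt disjnt Cs"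
      using assms
      by (auto simp: ordered_partitions_def partition_on_def sorted_wrt_iff_nth_less
          pairwise_def distinct_conv_nth)
    then have "sorted_wrt disjnt Ds"
      unfolding Cs[symmetric] sorted_wrt_disjnt_filter .
    then have disj: "d = e" if "i \<in> Ds ! d" "i \<in> Ds ! e" "d < L" "e < L" for i d e
      using that sorted_wrt_nth_less[of disjnt Ds] len
      by (cases d e rule: linorder_cases) (auto simp: disjnt_iff)
    have "\<Union>(set Ds) = \<Union>(set Cs)"
      unfolding Cs[symmetric] by auto
    then have cover: "\<Union>(set Ds) = {1..n}"
      using assms by (auto simp: ordered_partitions_def partition_on_def)
    then have "\<exists>d<L. i \<in> Ds ! d" if "i \<in> {1..n}" for i
      using that len by (metis UnionE in_set_conv_nth)
    then obtain f where f: "\<And>i. i \<in> {1..n} \<Longrightarrow> f i < L \<and> i \<in> Ds ! f i"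
      by metis
    define x where "x = (\<lambda>i\<in>{1..n}. Suc (f i))"
    have x: "x \<in> {1..n} \<rightarrow>\<^sub>E {1..L}"
      using f by (auto simp: x_def Suc_le_eq)
    have "cell n x (Suc d) = Ds ! d" if "d < L" for d
    proof -
      have "Ds ! d \<subseteq> {1..n}"
        using that cover len by auto
      then show ?thesis
        using f disj[of _ "f _" d] that by (auto simp: cell_def x_def)
    qed
    then have Ds: "Ds = map (cell n x) [1..<Suc L]"
      by (intro nth_equalityI) (auto simp: len simp del: upt_Suc)
    moreover have "ordered_clusters n x = Cs"
      using x ordered_clusters_conv_filter[of x n L] Cs unfolding Ds by auto
    ultimately show "Ds \<in> (\<lambda>x. map (cell n x) [1..<Suc L]) ` {x \<in> {1..n} \<rightarrow>\<^sub>E {1..L}. ordered_clusters n x = Cs}"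
      using x by blast
  qed
qed

section \<open>Beta moments and the law of the sample\<close>

lemma Beta_shift:
  fixes a b :: real
  assumes "a > 0" "b > 0"
  shows "Beta (a + real c) (b + real s) / Beta a b =
    pochhammer a c * pochhammer b s / pochhammer (a + b) (c + s)"
proof -
  have "x \<notin> \<int>\<^sub>\<le>\<^sub>0" if "x > 0" for x :: real
    using that by (auto elim!: nonpos_Ints_cases)
  then show ?thesis
    using assms by (simp add: Beta_def pochhammer_Gamma add_ac Gamma_eq_zero_iff)
qed

lemma has_bochner_integral_beta_moment:
  assumes "a > 0" "b > 0"
  shows "has_bochner_integral (beta_distribution a b) (\<lambda>u. u ^ c * (1 - u) ^ s)
    (pochhammer a c * pochhammer b s / pochhammer (a + b) (c + s))"
proof -
  let ?d = "\<lambda>u. indicator {0<..<1} u * (u powr (a - 1) * (1 - u) powr (b - 1)) / Beta a b"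
  let ?g = "\<lambda>u. indicator {0<..<1} u * (u powr (a + c - 1) * (1 - u) powr (b + s - 1)) / Beta a b"
  let ?m = "Beta (a + c) (b + s) / Beta a b"
  have B: "Beta a b > 0"
    using assms by (simp add: Beta_def Gamma_real_pos)
  \<comment> \<open>Outside the unit interval the integrand may be negative, but there the density vanishes.\<close>
  have ae: "AE u in beta_distribution a b. 0 \<le> u ^ c * (1 - u) ^ s"
    unfolding beta_distribution_def by (subst AE_density) (auto simp: indicator_def)
  have "((\<lambda>t. t powr (a + c - 1) * (1 - t) powr (b + s - 1)) has_integral Beta (a + c) (b + s)) {0<..<1}"
    using has_integral_Beta_real[of "a + c" "b + s"] assms by (simp add: has_integral_Icc_iff_Ioo)
  from has_integral_divide[OF this, of "Beta a b"]
  have "((\<lambda>t. if t \<in> {0<..<1} then t powr (a + c - 1) * (1 - t) powr (b + s - 1) / Beta a b else 0)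
      has_integral ?m) UNIV"
    by (subst has_integral_restrict_UNIV)
  then have "(?g has_integral ?m) UNIV"
    by (rule has_integral_eq[rotated]) (auto simp: indicator_def)
  then have g: "integral\<^sup>N lborel ?g = ennreal ?m"
    using B by (intro nn_integral_has_integral_lborel) auto
  have dg: "ennreal (?d u) * ennreal (u ^ c * (1 - u) ^ s) = ennreal (?g u)" for u
  proof (cases "u \<in> {0<..<1}")
    case True
    have "u powr (a + c - 1) = u powr (a - 1) * u ^ c"
      using True by (simp add: powr_add powr_diff powr_realpow)
    moreover have "(1 - u) powr (b + s - 1) = (1 - u) powr (b - 1) * (1 - u) ^ s"
      using True by (simp add: powr_add powr_diff powr_realpow)
    ultimately show ?thesis
      using True B by (subst ennreal_mult[symmetric]) (auto simp: mult_ac)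
  qed simp
  have "(\<integral>\<^sup>+u. ennreal (u ^ c * (1 - u) ^ s) \<partial>beta_distribution a b) = integral\<^sup>N lborel ?g"
    unfolding beta_distribution_def by (subst nn_integral_density) (simp_all only: dg, measurable)
  moreover have "?m \<ge> 0"
    using assms B by (simp add: Beta_def Gamma_real_pos less_imp_le)
  ultimately have "has_bochner_integral (beta_distribution a b) (\<lambda>u. u ^ c * (1 - u) ^ s) ?m"
    using ae g by (intro has_bochner_integral_nn_integral) auto
  then show ?thesis
    by (simp only: Beta_shift[OF assms])
qed

lemma boxes_prob_eq_prod:
  "boxes_prob \<alpha> \<theta> cs =
    (\<Prod>j<length cs. box_moment \<alpha> (\<theta> + real j * \<alpha>) (cs ! j) (sum_list (drop (Suc j) cs)))"
proof (induction cs arbitrary: \<theta>)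
  case (Cons c cs)
  show ?case
    unfolding boxes_prob.simps Cons.IH list.size add_Suc_right add_0_right prod.lessThan_Suc_shift
    by (simp add: algebra_simps)
qed simp

lemma boxes_prob_cells:
  assumes "x ` {1..n} \<subseteq> {1..L}"
  shows "boxes_prob \<alpha> \<theta> (map card (map (cell n x) [1..<Suc L])) =
    (\<Prod>j\<in>{1..L}. box_moment \<alpha> (\<theta> + real (j - 1) * \<alpha>) (card (cell n x j)) (card {i \<in> {1..n}. j < x i}))"
proof -
  have drop: "sum_list (drop (Suc j) (map card (map (cell n x) [1..<Suc L]))) = card {i \<in> {1..n}. Suc j < x i}"
    for j
  proof -
    have "sum_list (drop (Suc j) (map card (map (cell n x) [1..<Suc L]))) =
        (\<Sum>l\<in>{Suc (Suc j)..<Suc L}. card (cell n x l))"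
      by (simp add: drop_map o_def interv_sum_list_conv_sum_set_nat del: upt_Suc)
    also have "\<dots> = card (\<Union>l\<in>{Suc (Suc j)..<Suc L}. cell n x l)"
      by (intro card_UN_disjoint[symmetric]) (auto simp: cell_def)
    also have "(\<Union>l\<in>{Suc (Suc j)..<Suc L}. cell n x l) = {i \<in> {1..n}. Suc j < x i}"
      using assms by (auto simp: cell_def image_subset_iff less_Suc_eq_le)
    finally show ?thesis .
  qed
  have "boxes_prob \<alpha> \<theta> (map card (map (cell n x) [1..<Suc L])) =
    (\<Prod>j<L. box_moment \<alpha> (\<theta> + real j * \<alpha>) (card (cell n x (Suc j))) (card {i \<in> {1..n}. Suc j < x i}))"
    unfolding boxes_prob_eq_prod drop
    by (intro prod.cong) (simp_all del: upt_Suc)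
  also have "\<dots> = (\<Prod>j\<in>{1..L}. box_moment \<alpha> (\<theta> + real (j - 1) * \<alpha>) (card (cell n x j)) (card {i \<in> {1..n}. j < x i}))"
    by (rule prod.reindex_bij_witness[of _ "\<lambda>j. j - 1" Suc]) auto
  finally show ?thesis .
qed

text \<open>A sample point in box \<open>j\<close> contributes \<open>h j\<close> and one factor \<open>1 - h l\<close> for each earlier box \<open>l\<close>.  Grouping
  by boxes, \<open>h j\<close> occurs once for each point in box \<open>j\<close> and \<open>1 - h j\<close> once for each point beyond it.\<close>

lemma prod_stick_breaking:
  assumes "x ` {1..n} \<subseteq> {1..L}"
  shows "(\<Prod>i\<in>{1..n}. stick_breaking h (x i)) =
    (\<Prod>j\<in>{1..L}. h j ^ card (cell n x j) * (1 - h j) ^ card {i \<in> {1..n}. j < x i})"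
proof -
  have "(\<Prod>i\<in>{1..n}. stick_breaking h (x i)) =
      (\<Prod>i\<in>{1..n}. \<Prod>j\<in>{1..L}. (if x i = j then h j else 1) * (if j < x i then 1 - h j else 1))"
  proof (intro prod.cong refl)
    fix i assume "i \<in> {1..n}"
    then have x: "x i \<in> {1..L}"
      using assms by blast
    then have "stick_breaking h (x i) = h (x i) * (\<Prod>j\<in>{1..<x i}. 1 - h j)"
      by (simp add: stick_breaking_def)
    also have "(\<Prod>j\<in>{1..<x i}. 1 - h j) = (\<Prod>j\<in>{1..L}. if j < x i then 1 - h j else 1)"
      using x by (intro prod.mono_neutral_cong_left) auto
    also have "h (x i) = (\<Prod>j\<in>{1..L}. if x i = j then h j else 1)"
      using x by (simp add: prod.delta')
    finally show "stick_breaking h (x i) =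
        (\<Prod>j\<in>{1..L}. (if x i = j then h j else 1) * (if j < x i then 1 - h j else 1))"
      by (simp add: prod.distrib)
  qed
  also have "\<dots> = (\<Prod>j\<in>{1..L}. \<Prod>i\<in>{1..n}. (if x i = j then h j else 1) * (if j < x i then 1 - h j else 1))"
    by (rule prod.swap)
  also have "\<dots> = (\<Prod>j\<in>{1..L}. h j ^ card (cell n x j) * (1 - h j) ^ card {i \<in> {1..n}. j < x i})"
    by (intro prod.cong refl) (simp add: prod.distrib cell_def flip: prod.inter_filter)
  finally show ?thesis .
qed

text \<open>Regrouped by boxes, the monomial is a product of functions of distinct, hence independent, sticks,
  and only the sticks \<open>1, \<dots>, L\<close> occur.\<close>

lemma expectation_GEM_monomial:
  assumes "0 \<le> \<alpha>" "\<alpha> < 1" "\<theta> > - \<alpha>" "x ` {1..n} \<subseteq> {1..L}"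
  shows "(\<integral>p. (\<Prod>i\<in>{1..n}. p (x i)) \<partial>GEM \<alpha> \<theta>) =
    boxes_prob \<alpha> \<theta> (map card (map (cell n x) [1..<Suc L]))"
proof -
  \<comment> \<open>The index \<open>0\<close> does not occur in the product; \<open>max\<close> gives it a valid parameter, as
      \<open>\<theta>\<close> itself may be nonpositive, so that every \<open>B i\<close> is a probability measure.\<close>
  define B where "B i = beta_distribution (1 - \<alpha>) (\<theta> + real (max 1 i) * \<alpha>)" for i
  have pos: "\<theta> + real (max 1 i) * \<alpha> > 0" for i
  proof -
    have "1 * \<alpha> \<le> real (max 1 i) * \<alpha>"
      using assms by (intro mult_right_mono) auto
    then show ?thesis using assms by linarith
  qed
  interpret B: prob_space "B i" for i
    unfolding B_def using pos assms by (intro prob_space_beta_distribution) auto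
  interpret product_prob_space B UNIV
    by unfold_locales
  have sets_B [measurable_cong, simp]: "sets (B i) = sets borel" for i
    by (simp add: B_def)
  have GEM: "GEM \<alpha> \<theta> = distr (PiM {1..} B) seq_space stick_breaking"
  proof -
    have "(\<Pi>\<^sub>M i\<in>{1..}. beta_distribution (1 - \<alpha>) (\<theta> + real i * \<alpha>)) = PiM {1..} B"
      by (intro PiM_cong) (auto simp: B_def max_def)
    then show ?thesis by (simp add: GEM_def)
  qed
  have coord: "(\<lambda>h. h j) \<in> borel_measurable (PiM I B)" if "j \<in> I" for j I
    by (subst measurable_cong_sets[OF refl sets_B[of j, symmetric]])
       (rule measurable_component_singleton[OF that])
  have stick: "stick_breaking \<in> PiM {1..} B \<rightarrow>\<^sub>M seq_space"
    unfolding stick_breaking_def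
    by (intro measurable_restrict borel_measurable_times borel_measurable_prod borel_measurable_diff
         borel_measurable_const coord) auto
  have xi: "x i \<ge> 1" if "i \<in> {1..n}" for i
    using assms(4) that by (auto simp: image_subset_iff)
  let ?f = "\<lambda>j u. u ^ card (cell n x j) * (1 - u) ^ card {i \<in> {1..n}. j < x i} :: real"
  have moment: "has_bochner_integral (B j) (?f j)
      (box_moment \<alpha> (\<theta> + real (j - 1) * \<alpha>) (card (cell n x j)) (card {i \<in> {1..n}. j < x i}))"
    if "j \<ge> 1" for j
  proof -
    have b: "\<theta> + real (j - 1) * \<alpha> + \<alpha> = \<theta> + real (max 1 j) * \<alpha>"
      using that by (simp add: max_def algebra_simps)
    have ab: "\<theta> + real (j - 1) * \<alpha> + 1 = 1 - \<alpha> + (\<theta> + real (max 1 j) * \<alpha>)"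
      using that by (simp add: max_def algebra_simps)
    show ?thesis
      unfolding B_def box_moment_def b ab
      using assms(2) by (intro has_bochner_integral_beta_moment pos) simp
  qed
  have "(\<integral>p. (\<Prod>i\<in>{1..n}. p (x i)) \<partial>GEM \<alpha> \<theta>) = (\<integral>h. (\<Prod>i\<in>{1..n}. stick_breaking h (x i)) \<partial>PiM {1..} B)"
    unfolding GEM using xi
    by (intro integral_distr stick borel_measurable_prod measurable_component_singleton) auto
  also have "\<dots> = (\<integral>h. (\<Prod>j\<in>{1..L}. ?f j (restrict h {1..L} j)) \<partial>PiM {1..} B)"
    unfolding prod_stick_breaking[OF assms(4)] by simp
  also have "\<dots> = (\<integral>h. (\<Prod>j\<in>{1..L}. ?f j (h j)) \<partial>distr (PiM {1..} B) (PiM {1..L} B) (\<lambda>h. restrict h {1..L}))"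
  proof (rule integral_distr[symmetric])
    show "(\<lambda>h. restrict h {1..L}) \<in> PiM {1..} B \<rightarrow>\<^sub>M PiM {1..L} B"
      by (intro measurable_restrict_subset) auto
    show "(\<lambda>h. \<Prod>j\<in>{1..L}. ?f j (h j)) \<in> borel_measurable (PiM {1..L} B)"
      by (intro borel_measurable_prod borel_measurable_times borel_measurable_power
          borel_measurable_diff borel_measurable_const coord)
  qed
  also have "distr (PiM {1..} B) (PiM {1..L} B) (\<lambda>h. restrict h {1..L}) = PiM {1..L} B"
  proof -
    interpret P: product_prob_space B "{1..}" by unfold_locales
    show ?thesis by (rule P.distr_PiM_restrict_finite) auto
  qed
  also have "(\<integral>h. (\<Prod>j\<in>{1..L}. ?f j (h j)) \<partial>PiM {1..L} B) = (\<Prod>j\<in>{1..L}. integral\<^sup>L (B j) (?f j))"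
    using moment by (intro product_integral_prod) (auto simp: has_bochner_integral_iff)
  also have "\<dots> = boxes_prob \<alpha> \<theta> (map card (map (cell n x) [1..<Suc L]))"
    unfolding boxes_prob_cells[OF assms(4)]
    using moment by (intro prod.cong) (auto simp: has_bochner_integral_iff)
  finally show ?thesis .
qed

text \<open>Conditionally on \<open>P\<close> the probability is the product of the \<open>P\<^bsub>x i\<^esub>\<close>; take expectations.\<close>

lemma prob_sample_eq_expectation_GEM:
  assumes "prob_space M" "GEM_distributed M P \<alpha> \<theta>" "random_sample M P n X"
    and x: "\<And>i. i \<in> {1..n} \<Longrightarrow> x i \<ge> 1"
  shows "measure M {\<omega> \<in> space M. \<forall>i\<in>{1..n}. X i \<omega> = x i} = (\<integral>p. (\<Prod>i\<in>{1..n}. p (x i)) \<partial>GEM \<alpha> \<theta>)"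
    and "{\<omega> \<in> space M. \<forall>i\<in>{1..n}. X i \<omega> = x i} \<in> sets M"
proof -
  interpret prob_space M by fact
  define F where "F = sigma_gen M P"
  define S where "S = {\<omega> \<in> space M. \<forall>i\<in>{1..n}. X i \<omega> = x i}"
  have P: "rv_seq P \<in> M \<rightarrow>\<^sub>M seq_space" and D: "distr M seq_space (rv_seq P) = GEM \<alpha> \<theta>"
    using assms(2) by (auto simp: GEM_distributed_def)
  have X: "X i \<in> M \<rightarrow>\<^sub>M count_space {1..}" if "i \<in> {1..n}" for i
    using assms(3) that by (auto simp: random_sample_def cond_indep_vars_def)
  have single: "{\<omega> \<in> space M. X i \<omega> = x i} \<in> sets M" if "i \<in> {1..n}" for i
  proof -
    have "X i -` {x i} \<inter> space M \<in> sets M"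
      using x[OF that] by (intro measurable_sets[OF X[OF that]]) auto
    also have "X i -` {x i} \<inter> space M = {\<omega> \<in> space M. X i \<omega> = x i}"
      by auto
    finally show ?thesis .
  qed
  have S: "S \<in> sets M"
    unfolding S_def by (intro sets.sets_Collect_finite_All single) auto
  have "subalgebra M F"
    unfolding subalgebra_def F_def sigma_gen_def
    using sets_image_in_sets[OF refl P] by simp
  then interpret F: finite_measure_subalgebra M F
    by unfold_locales
  have "AE \<omega> in M. prob_given M F {\<omega>' \<in> space M. \<forall>i\<in>{1..n}. X i \<omega>' \<in> {x i}} \<omega> =
      (\<Prod>i\<in>{1..n}. prob_given M F {\<omega>' \<in> space M. X i \<omega>' \<in> {x i}} \<omega>)"
    using assms(3) x unfolding random_sample_def cond_indep_vars_def F_def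
    by (elim conjE allE[of _ "{1..n}"] allE[of _ "\<lambda>i. {x i}"]) auto
  moreover have "AE \<omega> in M. \<forall>i\<in>{1..n}. prob_given M F {\<omega>' \<in> space M. X i \<omega>' = x i} \<omega> = P (x i) \<omega>"
    using assms(3) x unfolding random_sample_def F_def
    by (intro AE_finite_allI) auto
  ultimately have ae: "AE \<omega> in M. real_cond_exp M F (indicator S) \<omega> = (\<Prod>i\<in>{1..n}. rv_seq P \<omega> (x i))"
  proof eventually_elim
    case (elim \<omega>)
    then show ?case
      using x by (simp add: prob_given_def S_def rv_seq_def)
  qed
  have prod_meas: "(\<lambda>p. \<Prod>i\<in>{1..n}. p (x i)) \<in> borel_measurable seq_space"
    using x by (intro borel_measurable_prod measurable_component_singleton) auto
  have "measure M S = (\<integral>\<omega>. indicator S \<omega> \<partial>M)"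
    using S by simp
  also have "\<dots> = (\<integral>\<omega>. real_cond_exp M F (indicator S) \<omega> \<partial>M)"
    using S by (intro F.real_cond_exp_int(2)[symmetric]) (simp add: integrable_indicator_iff less_top[symmetric])
  also have "\<dots> = (\<integral>\<omega>. (\<Prod>i\<in>{1..n}. rv_seq P \<omega> (x i)) \<partial>M)"
    using ae measurable_compose[OF P prod_meas] by (intro integral_cong_AE) auto
  also have "\<dots> = (\<integral>p. (\<Prod>i\<in>{1..n}. p (x i)) \<partial>GEM \<alpha> \<theta>)"
    unfolding D[symmetric] by (intro integral_distr[symmetric] P prod_meas)
  finally show "measure M {\<omega> \<in> space M. \<forall>i\<in>{1..n}. X i \<omega> = x i} = (\<integral>p. (\<Prod>i\<in>{1..n}. p (x i)) \<partial>GEM \<alpha> \<theta>)"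
    and "{\<omega> \<in> space M. \<forall>i\<in>{1..n}. X i \<omega> = x i} \<in> sets M"
    using S by (simp_all add: S_def)
qed

section \<open>The law of the ordered clusters\<close>

lemma ordered_clusters_cong:
  assumes "\<And>i. i \<in> {1..n} \<Longrightarrow> x i = y i"
  shows "ordered_clusters n x = ordered_clusters n y"
proof -
  have "cell n x = cell n y"
    using assms by (auto simp: cell_def fun_eq_iff)
  moreover have "x ` {1..n} = y ` {1..n}"
    using assms by (intro image_cong) auto
  ultimately show ?thesis
    by (simp only: ordered_clusters_eq_cells)
qed

lemma finite_nonempty_ordered_partition:
  assumes "Cs \<in> ordered_partitions A" "finite A"
  shows "\<forall>C\<in>set Cs. finite C \<and> C \<noteq> {}"
  using assms by (auto simp: ordered_partitions_def partition_on_def intro: finite_subset)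

text \<open>Restricted to values at most \<open>L\<close>, the event is a finite union of events that specify the whole
  sample, so its probability is the finite padded sum; then let \<open>L\<close> tend to infinity.\<close>

lemma prob_ordered_clusters:
  assumes "prob_space M" "0 \<le> \<alpha>" "\<alpha> < 1" "\<theta> > - \<alpha>" "GEM_distributed M P \<alpha> \<theta>" "random_sample M P n X"
    and Cs: "Cs \<in> ordered_partitions {1..n}"
  shows "measure M {\<omega> \<in> space M. ordered_clusters n (\<lambda>i. X i \<omega>) = Cs} = ordered_eppf \<alpha> \<theta> (map card Cs)"
    and "{\<omega> \<in> space M. ordered_clusters n (\<lambda>i. X i \<omega>) = Cs} \<in> sets M"
proof -
  interpret prob_space M by fact
  define T where "T L = {x \<in> {1..n} \<rightarrow>\<^sub>E {1..L}. ordered_clusters n x = Cs}" for L :: nat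
  define A where "A x = {\<omega> \<in> space M. \<forall>i\<in>{1..n}. X i \<omega> = x i}" for x
  define E where "E L = {\<omega> \<in> space M. ordered_clusters n (\<lambda>i. X i \<omega>) = Cs \<and> (\<forall>i\<in>{1..n}. X i \<omega> \<le> L)}" for L
  have T_range: "x ` {1..n} \<subseteq> {1..L}" if "x \<in> T L" for x L
    using that by (auto simp: T_def)
  have finT: "finite (T L)" for L
    unfolding T_def by (rule finite_subset[OF _ finite_PiE[of "{1..n}" "\<lambda>_. {1..L}"]]) auto
  have X_ge: "X i \<omega> \<ge> 1" if "i \<in> {1..n}" "\<omega> \<in> space M" for i \<omega>
  proof -
    have "X i \<in> M \<rightarrow>\<^sub>M count_space {1..}"
      using assms(6) that by (auto simp: random_sample_def cond_indep_vars_def)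
    from measurable_space[OF this that(2)] show ?thesis
      by simp
  qed
  have A_sets: "A x \<in> sets M" and A_prob: "measure M (A x) = boxes_prob \<alpha> \<theta> (map card (map (cell n x) [1..<Suc L]))"
    if "x \<in> T L" for x L
  proof -
    have x: "x i \<ge> 1" if "i \<in> {1..n}" for i
      using T_range[OF \<open>x \<in> T L\<close>] that by (auto simp: image_subset_iff)
    show "A x \<in> sets M"
      unfolding A_def by (rule prob_sample_eq_expectation_GEM(2)[OF assms(1,5,6) x])
    have "measure M (A x) = (\<integral>p. (\<Prod>i\<in>{1..n}. p (x i)) \<partial>GEM \<alpha> \<theta>)"
      unfolding A_def by (rule prob_sample_eq_expectation_GEM(1)[OF assms(1,5,6) x])
    also have "\<dots> = boxes_prob \<alpha> \<theta> (map card (map (cell n x) [1..<Suc L]))"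
      by (rule expectation_GEM_monomial[OF assms(2-4) T_range[OF that]])
    finally show "measure M (A x) = boxes_prob \<alpha> \<theta> (map card (map (cell n x) [1..<Suc L]))" .
  qed
  have E_eq: "E L = (\<Union>x\<in>T L. A x)" for L
  proof (intro equalityI subsetI)
    fix \<omega> assume \<omega>: "\<omega> \<in> E L"
    define x where "x = (\<lambda>i\<in>{1..n}. X i \<omega>)"
    have "ordered_clusters n x = ordered_clusters n (\<lambda>i. X i \<omega>)"
      by (rule ordered_clusters_cong) (simp add: x_def)
    moreover have "x \<in> {1..n} \<rightarrow>\<^sub>E {1..L}"
      unfolding x_def using \<omega> X_ge[of _ \<omega>] by (intro restrict_PiE_iff[THEN iffD2]) (auto simp: E_def)
    ultimately have "x \<in> T L"
      using \<omega> by (simp add: T_def E_def)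
    moreover have "\<omega> \<in> A x"
      using \<omega> by (simp add: A_def E_def x_def)
    ultimately show "\<omega> \<in> (\<Union>x\<in>T L. A x)" by blast
  next
    fix \<omega> assume "\<omega> \<in> (\<Union>x\<in>T L. A x)"
    then obtain x where x: "x \<in> T L" "\<omega> \<in> A x" by blast
    have eq: "X i \<omega> = x i" if "i \<in> {1..n}" for i
      using x(2) that by (simp add: A_def)
    have "ordered_clusters n (\<lambda>i. X i \<omega>) = ordered_clusters n x"
      by (rule ordered_clusters_cong) (rule eq)
    then show "\<omega> \<in> E L"
      using x T_range[OF x(1)] eq by (auto simp: E_def T_def A_def image_subset_iff)
  qed
  have disj: "disjoint_family_on A (T L)" for L
    unfolding disjoint_family_on_def
  proof (intro ballI impI)
    fix x y assume xy: "x \<in> T L" "y \<in> T L" "x \<noteq> y"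
    then obtain i where "i \<in> {1..n}" "x i \<noteq> y i"
      using PiE_ext[of x "{1..n}" "\<lambda>_. {1..L}" y] by (auto simp: T_def)
    then show "A x \<inter> A y = {}"
      by (auto simp: A_def)
  qed
  have E_sets: "E L \<in> sets M" for L
    unfolding E_eq using finT A_sets by (intro sets.finite_UN) auto
  have E_prob: "measure M (E L) = padded_sum \<alpha> \<theta> Cs L" for L
  proof -
    have "measure M (E L) = (\<Sum>x\<in>T L. measure M (A x))"
      unfolding E_eq using finT A_sets disj by (intro finite_measure_finite_Union) auto
    also have "\<dots> = (\<Sum>x\<in>T L. boxes_prob \<alpha> \<theta> (map card (map (cell n x) [1..<Suc L])))"
      by (intro sum.cong refl A_prob)
    also have "\<dots> = (\<Sum>Ds\<in>paddings L Cs. boxes_prob \<alpha> \<theta> (map card Ds))"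
      unfolding T_def by (intro sum.reindex_bij_betw bij_betw_samples_paddings Cs)
    finally show ?thesis
      by (simp add: padded_sum_def)
  qed
  have union: "(\<Union>L. E L) = {\<omega> \<in> space M. ordered_clusters n (\<lambda>i. X i \<omega>) = Cs}"
  proof -
    have "\<exists>L. \<forall>i\<in>{1..n}. X i \<omega> \<le> L" for \<omega>
      by (intro exI[of _ "Max ((\<lambda>i. X i \<omega>) ` {1..n})"]) simp
    then show ?thesis
      unfolding E_def by blast
  qed
  have "(\<lambda>L. measure M (E L)) \<longlonglongrightarrow> measure M (\<Union>L. E L)"
    using E_sets by (intro finite_Lim_measure_incseq) (force simp: incseq_def E_def)+
  then show "measure M {\<omega> \<in> space M. ordered_clusters n (\<lambda>i. X i \<omega>) = Cs} = ordered_eppf \<alpha> \<theta> (map card Cs)"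
    unfolding union E_prob
    by (rule LIMSEQ_unique)
       (rule padded_sum_tendsto[OF assms(2-4) finite_nonempty_ordered_partition[OF Cs]], simp)
  show "{\<omega> \<in> space M. ordered_clusters n (\<lambda>i. X i \<omega>) = Cs} \<in> sets M"
    unfolding union[symmetric] using E_sets by (intro sets.countable_UN) auto
qed

section \<open>Conditioning on a listing of the block sizes\<close>

lemma finite_ordered_partitions:
  assumes "finite A"
  shows "finite (ordered_partitions A)"
proof (rule finite_subset)
  show "ordered_partitions A \<subseteq> (\<Union>\<Gamma>\<in>{\<Gamma>. partition_on A \<Gamma>}. permutations_of_set \<Gamma>)"
    by (auto simp: ordered_partitions_def permutations_of_set_def)
  show "finite (\<Union>\<Gamma>\<in>{\<Gamma>. partition_on A \<Gamma>}. permutations_of_set \<Gamma>)"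
    using finitely_many_partition_on[OF assms] by auto
qed

lemma value_ordered_freqs_eq: "value_ordered_freqs n x = map card (ordered_clusters n x)"
  by (simp add: value_ordered_freqs_def ordered_clusters_def)

text \<open>Here \<open>T\<close> is any statistic of the unordered partition that lists its block sizes.  The joint
  probability of \<open>T = ns\<close> and value-ordered sizes \<open>ms\<close> is \<open>K\<close> times the probability of \<open>ms\<close> under the biased
  permutation of \<open>ns\<close>, with \<open>K\<close> independent of \<open>ms\<close>.  Summing over \<open>ms\<close> identifies \<open>K\<close> as the probability
  of \<open>T = ns\<close>.\<close>

lemma cond_prob_value_ordered_freqs:
  assumes "prob_space M" "0 \<le> \<alpha>" "\<alpha> < 1" "\<theta> > - \<alpha>" "GEM_distributed M P \<alpha> \<theta>" "random_sample M P n X"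
    and T: "\<And>\<Gamma>. partition_on {1..n} \<Gamma> \<Longrightarrow> \<exists>Bs. distinct Bs \<and> set Bs = \<Gamma> \<and> map card Bs = T \<Gamma>"
    and pos: "\<P>(\<omega> in M. T (clusters n (\<lambda>i. X i \<omega>)) = ns) > 0"
  shows "\<P>(\<omega> in M. value_ordered_freqs n (\<lambda>i. X i \<omega>) = ms \<bar> T (clusters n (\<lambda>i. X i \<omega>)) = ns) =
    pmf (size_biased_permutation \<alpha> ns) ms"
proof -
  interpret prob_space M by fact
  let ?O = "\<lambda>\<omega>. ordered_clusters n (\<lambda>i. X i \<omega>)"
  define R where "R = {\<Gamma>. partition_on {1..n} \<Gamma> \<and> T \<Gamma> = ns}"
  define Q where "Q ms = {Cs \<in> ordered_partitions {1..n}. map card Cs = ms \<and> T (set Cs) = ns}" for ms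
  define J where "J ms = {\<omega> \<in> space M. map card (?O \<omega>) = ms \<and> T (set (?O \<omega>)) = ns}" for ms
  define K where "K = real (card R) * eppf \<alpha> \<theta> ns"
  have finR: "finite R"
    unfolding R_def by (rule finite_subset[OF _ finitely_many_partition_on[of "{1..n}"]]) auto
  have finQ: "finite (Q ms)" for ms
    unfolding Q_def by (rule finite_subset[OF _ finite_ordered_partitions[of "{1..n}"]]) auto
  have J_eq: "J ms = (\<Union>Cs\<in>Q ms. {\<omega> \<in> space M. ?O \<omega> = Cs})" for ms
    using ordered_clusters_in_ordered_partitions by (auto simp: J_def Q_def)
  have O_sets: "{\<omega> \<in> space M. ?O \<omega> = Cs} \<in> sets M"
    and O_prob: "measure M {\<omega> \<in> space M. ?O \<omega> = Cs} = ordered_eppf \<alpha> \<theta> (map card Cs)" if "Cs \<in> Q ms" for Cs ms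
    using prob_ordered_clusters[OF assms(1-6), of Cs] that by (auto simp: Q_def)
  have J_sets: "J ms \<in> sets M" for ms
    unfolding J_eq using finQ O_sets by (intro sets.finite_UN) auto
  have orderings: "real (card {Cs \<in> permutations_of_set \<Gamma>. map card Cs = ms}) * ordered_eppf \<alpha> \<theta> ms =
      eppf \<alpha> \<theta> ns * pmf (size_biased_permutation \<alpha> ns) ms"
    and supp: "pmf (size_biased_permutation \<alpha> ns) ms \<noteq> 0 \<Longrightarrow> ms \<in> map card ` permutations_of_set \<Gamma>"
    if "\<Gamma> \<in> R" for \<Gamma> ms
  proof -
    obtain Bs where Bs: "distinct Bs" "set Bs = \<Gamma>" "map card Bs = ns"
      using T[of \<Gamma>] \<open>\<Gamma> \<in> R\<close> by (auto simp: R_def)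
    have "\<forall>B\<in>set Bs. finite B \<and> B \<noteq> {}"
      using \<open>\<Gamma> \<in> R\<close> Bs by (intro finite_nonempty_ordered_partition[of _ "{1..n}"]) (auto simp: ordered_partitions_def R_def)
    note * = card_orderings_times_ordered_eppf[OF assms(3) Bs(1) this] pmf_size_biased_permutation[OF assms(3) Bs(1) this]
    show "real (card {Cs \<in> permutations_of_set \<Gamma>. map card Cs = ms}) * ordered_eppf \<alpha> \<theta> ms =
        eppf \<alpha> \<theta> ns * pmf (size_biased_permutation \<alpha> ns) ms"
      using *(1)[of ms \<theta>] Bs by simp
    assume "pmf (size_biased_permutation \<alpha> ns) ms \<noteq> 0"
    then have "card {Cs \<in> permutations_of_set \<Gamma>. map card Cs = ms} \<noteq> 0"
      using *(2)[of ms] Bs by (intro notI) simp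
    then have "{Cs \<in> permutations_of_set \<Gamma>. map card Cs = ms} \<noteq> {}"
      by (metis card.empty)
    then show "ms \<in> map card ` permutations_of_set \<Gamma>"
      by blast
  qed
  have J_prob: "measure M (J ms) = K * pmf (size_biased_permutation \<alpha> ns) ms" for ms
  proof -
    have "measure M (J ms) = (\<Sum>Cs\<in>Q ms. measure M {\<omega> \<in> space M. ?O \<omega> = Cs})"
      unfolding J_eq using finQ O_sets
      by (intro finite_measure_finite_Union) (auto simp: disjoint_family_on_def)
    also have "\<dots> = (\<Sum>Cs\<in>Q ms. ordered_eppf \<alpha> \<theta> ms)"
    proof (intro sum.cong refl)
      fix Cs assume "Cs \<in> Q ms"
      then show "measure M {\<omega> \<in> space M. ?O \<omega> = Cs} = ordered_eppf \<alpha> \<theta> ms"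
        using O_prob[of Cs ms] by (simp add: Q_def)
    qed
    also have "\<dots> = real (card (Q ms)) * ordered_eppf \<alpha> \<theta> ms"
      by simp
    also have "Q ms = (\<Union>\<Gamma>\<in>R. {Cs \<in> permutations_of_set \<Gamma>. map card Cs = ms})"
      by (auto simp: Q_def R_def ordered_partitions_def permutations_of_set_def)
    also have "card \<dots> = (\<Sum>\<Gamma>\<in>R. card {Cs \<in> permutations_of_set \<Gamma>. map card Cs = ms})"
      using finR by (intro card_UN_disjoint) (auto dest: permutations_of_setD)
    also have "real \<dots> * ordered_eppf \<alpha> \<theta> ms =
        (\<Sum>\<Gamma>\<in>R. eppf \<alpha> \<theta> ns * pmf (size_biased_permutation \<alpha> ns) ms)"
      unfolding of_nat_sum sum_distrib_right by (intro sum.cong refl orderings)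
    finally show ?thesis
      by (simp add: K_def)
  qed
  have fin: "finite (map card ` ordered_partitions {1..n})"
    by (intro finite_imageI finite_ordered_partitions) auto
  have total: "measure M {\<omega> \<in> space M. T (clusters n (\<lambda>i. X i \<omega>)) = ns} =
      K * (\<Sum>ms\<in>map card ` ordered_partitions {1..n}. pmf (size_biased_permutation \<alpha> ns) ms)"
  proof -
    have "{\<omega> \<in> space M. T (clusters n (\<lambda>i. X i \<omega>)) = ns} = (\<Union>ms\<in>map card ` ordered_partitions {1..n}. J ms)"
      using ordered_clusters_in_ordered_partitions by (auto simp: J_def set_ordered_clusters)
    also have "measure M \<dots> = (\<Sum>ms\<in>map card ` ordered_partitions {1..n}. measure M (J ms))"
      using J_sets by (intro finite_measure_finite_Union fin) (auto simp: disjoint_family_on_def J_def)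
    finally show ?thesis
      by (simp add: J_prob sum_distrib_left)
  qed
  then have "K \<noteq> 0"
    using pos by auto
  then obtain \<Gamma> where \<Gamma>: "\<Gamma> \<in> R"
    using finR by (auto simp: K_def card_eq_0_iff)
  \<comment> \<open>The finite sum in \<open>total\<close> runs over the whole support, so it equals \<open>1\<close>.\<close>
  have "set_pmf (size_biased_permutation \<alpha> ns) \<subseteq> map card ` ordered_partitions {1..n}"
  proof
    fix ms assume "ms \<in> set_pmf (size_biased_permutation \<alpha> ns)"
    then have "ms \<in> map card ` permutations_of_set \<Gamma>"
      using supp[OF \<Gamma>] by (simp add: set_pmf_iff)
    then show "ms \<in> map card ` ordered_partitions {1..n}"
      using \<Gamma> by (auto simp: ordered_partitions_def permutations_of_set_def R_def)
  qed
  then have "measure M {\<omega> \<in> space M. T (clusters n (\<lambda>i. X i \<omega>)) = ns} = K"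
    using total fin by (simp add: sum_pmf_eq_1)
  moreover have "{\<omega> \<in> space M. value_ordered_freqs n (\<lambda>i. X i \<omega>) = ms \<and> T (clusters n (\<lambda>i. X i \<omega>)) = ns} = J ms"
    by (auto simp: J_def value_ordered_freqs_eq set_ordered_clusters)
  ultimately show ?thesis
    using J_prob[of ms] \<open>K \<noteq> 0\<close> by (simp add: cond_prob_def)
qed

lemma ranked_listing:
  assumes "finite \<Gamma>"
  shows "\<exists>Bs. distinct Bs \<and> set Bs = \<Gamma> \<and>
    map card Bs = rev (sorted_list_of_multiset (image_mset card (mset_set \<Gamma>)))"
proof -
  obtain Bs where Bs: "set Bs = \<Gamma>" "distinct Bs"
    using finite_distinct_list[OF assms] by blast
  have "image_mset card (mset_set \<Gamma>) = mset (map card Bs)"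
    using Bs by (metis mset_map mset_set_set)
  then have "sorted_list_of_multiset (image_mset card (mset_set \<Gamma>)) = sort (map card Bs)"
    by (simp only: sorted_list_of_multiset_mset)
  moreover have "map card (sort_key card Bs) = sort (map card Bs)"
    by (rule properties_for_sort[symmetric]) simp_all
  ultimately show ?thesis
    using Bs by (intro exI[of _ "rev (sort_key card Bs)"]) (simp add: rev_map[symmetric])
qed

text \<open>Disjoint nonempty blocks have distinct least elements, so sorting by them lists every block once.\<close>

lemma appearance_listing:
  assumes "partition_on A \<Gamma>" "finite (A :: nat set)"
  shows "\<exists>Bs. distinct Bs \<and> set Bs = \<Gamma> \<and> map card Bs = map card (sorted_key_list_of_set Min \<Gamma>)"
proof -
  have fin: "finite \<Gamma>"
    using finite_elements[OF assms(2,1)] .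
  have "inj_on Min \<Gamma>"
  proof (rule inj_onI)
    fix B C assume BC: "B \<in> \<Gamma>" "C \<in> \<Gamma>" "Min B = Min C"
    have "finite D \<and> D \<noteq> {}" if "D \<in> \<Gamma>" for D
      using that assms by (auto simp: partition_on_def intro: finite_subset)
    then have "Min B \<in> B \<inter> C"
      using BC by (metis IntI Min_in)
    then show "B = C"
      using BC assms(1) by (auto simp: partition_on_def disjoint_def)
  qed
  then show ?thesis
    using sorted_key_list_of_set_lists[of Min \<Gamma>] fin by blast
qed

theorem theorem1p1:
  fixes M :: "'a measure" and P :: "nat \<Rightarrow> 'a \<Rightarrow> real" and X :: "nat \<Rightarrow> 'a \<Rightarrow> nat"
    and \<alpha> \<theta> :: real and n :: nat
  assumes "prob_space M"
    and "0 \<le> \<alpha>" and "\<alpha> < 1" and "\<theta> > - \<alpha>" and "n \<ge> 1"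
    and "GEM_distributed M P \<alpha> \<theta>"
    and "random_sample M P n X"
  shows "(\<forall>ns. composition n ns \<and> \<P>(\<omega> in M. ranked_freqs n (\<lambda>i. X i \<omega>) = ns) > 0 \<longrightarrow>
            (\<forall>ms. \<P>(\<omega> in M. value_ordered_freqs n (\<lambda>i. X i \<omega>) = ms
                               \<bar> ranked_freqs n (\<lambda>i. X i \<omega>) = ns) =
                    pmf (size_biased_permutation \<alpha> ns) ms)) \<and>
         (\<forall>ns. composition n ns \<and> \<P>(\<omega> in M. appearance_ordered_freqs n (\<lambda>i. X i \<omega>) = ns) > 0 \<longrightarrow>
            (\<forall>ms. \<P>(\<omega> in M. value_ordered_freqs n (\<lambda>i. X i \<omega>) = ms
                               \<bar> appearance_ordered_freqs n (\<lambda>i. X i \<omega>) = ns) =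
                    pmf (size_biased_permutation \<alpha> ns) ms))"
proof (intro conjI allI impI; elim conjE)
  fix ns ms
  assume "\<P>(\<omega> in M. ranked_freqs n (\<lambda>i. X i \<omega>) = ns) > 0"
  then show "\<P>(\<omega> in M. value_ordered_freqs n (\<lambda>i. X i \<omega>) = ms \<bar> ranked_freqs n (\<lambda>i. X i \<omega>) = ns) =
      pmf (size_biased_permutation \<alpha> ns) ms"
    unfolding ranked_freqs_def
    by (intro cond_prob_value_ordered_freqs[OF assms(1-4,6,7)] ranked_listing finite_elements[of "{1..n}"]) auto
next
  fix ns ms
  assume "\<P>(\<omega> in M. appearance_ordered_freqs n (\<lambda>i. X i \<omega>) = ns) > 0"
  then show "\<P>(\<omega> in M. value_ordered_freqs n (\<lambda>i. X i \<omega>) = ms \<bar> appearance_ordered_freqs n (\<lambda>i. X i \<omega>) = ns) =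
      pmf (size_biased_permutation \<alpha> ns) ms"
    unfolding appearance_ordered_freqs_def
    by (intro cond_prob_value_ordered_freqs[OF assms(1-4,6,7)] appearance_listing) auto
qed

end
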